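(* Let $\mathcal{H}$ be a class of functions mapping $\mathcal{X}$ to $\mathbb{R}$. Let $P_{(X,\zeta)}$ be a joint distribution on $\mathcal{X}\times\mathbb{R}$ with marginal distributions $P_X$ and $P_\zeta$, and let $S_n=(X_i,\zeta_i)_{i=1}^n$ be $n$ i.i.d. samples from $P_{(X,\zeta)}$. Fix any $\gamma>0$ and define the random variable $$U=U(S_n)=\sup_{h\in\operatorname{star}(\mathcal{H})}\Big\{\sum_{i=1}^n\Big(\zeta_ih(X_i)-\mathbf{E}_{(X,\zeta)\sim P_{(X,\zeta)}}[\zeta h(X)]-\gamma h(X_i)^2-\gamma\mathbf{E}_{X\sim P_X}[h(X)^2]\Big)\Big\}.$$ Suppose that there exist positive constants $\kappa$ and $\sigma$ such that $\sup_{h\in\mathcal{H}}\|h\|_{L_\infty(P_X)}\le\kappa$ and $\|\zeta\|_{L_\infty(P_\zeta)}\le\sigma$. Then, for $\eta=8(\sigma^2\gamma^{-1}+\gamma\kappa^2)$ and any $\lambda\in(0,1/\eta)$, $$\log\mathbf{E}\,e^{\lambda(U-\mathbf{E}U)}\le\frac{\lambda^2\eta\,\mathbf{E}U}{2(1-\eta\lambda)}.$$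
   Context: $\operatorname{star}(\mathcal{H})=\{\lambda h:h\in\mathcal{H},\lambda\in[0,1]\}$, where $(\lambda h)(x)=\lambda h(x)$. All functions are assumed measurable. *)

theory Defs
  imports "HOL-Probability.Probability"
begin

definition star :: "('a \<Rightarrow> real) set \<Rightarrow> ('a \<Rightarrow> real) set" where
  "star H = {(\<lambda>x. c * h x) | c h. h \<in> H \<and> c \<in> {0..1}}"

definition Linf_norm :: "'a measure \<Rightarrow> ('a \<Rightarrow> real) \<Rightarrow> ereal" where
  "Linf_norm M f = esssup M (\<lambda>x. ereal \<bar>f x\<bar>)"

text \<open>
  A law P on the product of the measurable space N with the real line, and its two marginals.
\<close>

definition marg_X :: "'a measure \<Rightarrow> ('a \<times> real) measure \<Rightarrow> 'a measure" where
  "marg_X N P = distr P N fst"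

definition marg_zeta :: "('a \<times> real) measure \<Rightarrow> real measure" where
  "marg_zeta P = distr P borel snd"

text \<open>
  The statistic U as a function of a sample s, whose i-th entry is the pair of the i-th covariate
  and the i-th noise variable (indices 0, ..., n - 1). The supremum is a supremum of reals: for
  nonempty H and square-integrable noise it is over a nonempty set bounded above at every s, since
  z * y - \<gamma> * y^2 is at most z^2 / (4 * \<gamma>) for all real y, z.
\<close>

definition U_stat ::
    "'a measure \<Rightarrow> ('a \<times> real) measure \<Rightarrow> ('a \<Rightarrow> real) set \<Rightarrow> real \<Rightarrow> nat
      \<Rightarrow> (nat \<Rightarrow> 'a \<times> real) \<Rightarrow> real" where
  "U_stat N P H \<gamma> n s =
     (SUP h\<in>star H. \<Sum>i<n.
        snd (s i) * h (fst (s i)) - (\<integral>(x, z). z * h x \<partial>P)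
        - \<gamma> * (h (fst (s i)))\<^sup>2 - \<gamma> * (\<integral>x. (h x)\<^sup>2 \<partial>marg_X N P))"

end

(*
  Write V for the sum over i of the conditional expectation of the squared positive part
  (U - U_i)_+^2, where U_i is U with the i-th sample point resampled. The entropy method gives the
  claim from V <= (eta / 2) U: subadditivity of the entropy, the bound
  Ent(exp W) <= E exp(W x) (W x - W y)_+^2 in one variable, and Herbst's integration of the
  resulting differential inequality for the logarithm of the moment generating function.

  For the bound on V, take a near-maximiser h of U and f = zeta h - gamma h^2. Then
  U - U_i <= f(s_i) - f(s_i') up to a small error, and V is at most
  4 (sigma^2 + gamma^2 kappa^2) Q with Q = sum_i h(X_i)^2 + n E h^2. Comparing h with c h in the star
  hull and letting c tend to 1 gives gamma Q <= U.

  For uncountable H the exceptional null sets depend on h, so h need not be bounded by kappa at the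
  sample that h was selected from. Only f(s_i)_+ <= sigma |h(X_i)| is needed there; the bound kappa
  is needed only at the resampled point s_i', which is independent of the choice of h.
*)
theory Submission
  imports Defs
begin

section \<open>Entropy of exponentials\<close>

lemma (in prob_space) integrable_bounded:
  fixes f :: "'a \<Rightarrow> real"
  assumes "f \<in> borel_measurable M" "\<And>x. x \<in> space M \<Longrightarrow> \<bar>f x\<bar> \<le> B"
  shows "integrable M f"
  using assms by (intro integrable_const_bound[where B = B]) auto

lemma (in prob_space) abs_integral_le:
  fixes f :: "'a \<Rightarrow> real"
  assumes "f \<in> borel_measurable M" "AE x in M. \<bar>f x\<bar> \<le> B"
  shows "\<bar>\<integral>x. f x \<partial>M\<bar> \<le> B"
proof -
  have i: "integrable M f"
    using assms by (intro integrable_const_bound[where B = B]) auto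
  have "\<bar>\<integral>x. f x \<partial>M\<bar> \<le> (\<integral>x. \<bar>f x\<bar> \<partial>M)" by (rule integral_abs_bound)
  also have "\<dots> \<le> (\<integral>x. B \<partial>M)"
    using i assms(2) by (intro integral_mono_AE) auto
  also have "\<dots> = B" by (simp add: prob_space)
  finally show ?thesis .
qed

text \<open>The entropy functional Ent(f) = E (f ln f) - (E f) ln (E f) at f = exp W. Working with
  the exponent \<open>W\<close> makes f ln f equal to \<open>exp (W x) * W x\<close>.\<close>

definition ent_exp :: "'a measure \<Rightarrow> ('a \<Rightarrow> real) \<Rightarrow> real" where
  "ent_exp M W = (\<integral>x. exp (W x) * W x \<partial>M) - (\<integral>x. exp (W x) \<partial>M) * ln (\<integral>x. exp (W x) \<partial>M)"

lemma (in prob_space) integrable_exp_mult: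
  fixes V W :: "'a \<Rightarrow> real"
  assumes "W \<in> borel_measurable M" "\<And>x. x \<in> space M \<Longrightarrow> \<bar>W x\<bar> \<le> B"
    and "V \<in> borel_measurable M" "\<And>x. x \<in> space M \<Longrightarrow> \<bar>V x\<bar> \<le> C"
  shows "integrable M (\<lambda>x. exp (W x) * V x)"
proof (rule integrable_bounded[where B = "exp B * C"])
  show "\<bar>exp (W x) * V x\<bar> \<le> exp B * C" if "x \<in> space M" for x
    using assms(2,4)[OF that] by (auto simp: abs_mult intro!: mult_mono)
qed (use assms(1,3) in auto)

lemma (in prob_space) integrable_exp_bounded:
  fixes W :: "'a \<Rightarrow> real"
  assumes "W \<in> borel_measurable M" "\<And>x. x \<in> space M \<Longrightarrow> \<bar>W x\<bar> \<le> B"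
  shows "integrable M (\<lambda>x. exp (W x))"
  using integrable_exp_mult[OF assms, of "\<lambda>_. 1" 1] by simp

lemma (in prob_space) integral_exp_bounds:
  fixes W :: "'a \<Rightarrow> real"
  assumes "W \<in> borel_measurable M" "\<And>x. x \<in> space M \<Longrightarrow> \<bar>W x\<bar> \<le> B"
  shows "exp (- B) \<le> (\<integral>x. exp (W x) \<partial>M)" "(\<integral>x. exp (W x) \<partial>M) \<le> exp B"
proof -
  have "(\<integral>x. exp (- B) \<partial>M) \<le> (\<integral>x. exp (W x) \<partial>M)"
    using assms(2) by (intro integral_mono integrable_exp_bounded[OF assms]) (auto simp: abs_le_iff minus_le_iff)
  then show "exp (- B) \<le> (\<integral>x. exp (W x) \<partial>M)" by (simp add: prob_space)
  have "(\<integral>x. exp (W x) \<partial>M) \<le> (\<integral>x. exp B \<partial>M)"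
    using assms(2) by (intro integral_mono integrable_exp_bounded[OF assms]) (auto simp: abs_le_iff minus_le_iff)
  then show "(\<integral>x. exp (W x) \<partial>M) \<le> exp B" by (simp add: prob_space)
qed

lemma (in prob_space) abs_ent_exp_le:
  fixes W :: "'a \<Rightarrow> real"
  assumes W: "W \<in> borel_measurable M" "\<And>x. x \<in> space M \<Longrightarrow> \<bar>W x\<bar> \<le> B"
  shows "\<bar>ent_exp M W\<bar> \<le> 2 * (exp B * B)"
proof -
  have 1: "\<bar>\<integral>x. exp (W x) * W x \<partial>M\<bar> \<le> exp B * B"
  proof (rule abs_integral_le)
    show "AE x in M. \<bar>exp (W x) * W x\<bar> \<le> exp B * B"
      using W(2) by (auto simp: abs_mult abs_le_iff intro!: AE_I2 mult_mono)
  qed (use W(1) in measurable)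
  let ?m = "\<integral>x. exp (W x) \<partial>M"
  have 2: "exp (- B) \<le> ?m" "?m \<le> exp B" using integral_exp_bounds[OF W] by auto
  then have "?m > 0" by (meson exp_gt_zero less_le_trans)
  then have "\<bar>ln ?m\<bar> \<le> B"
    using 2 by (simp add: abs_le_iff ln_ge_iff minus_le_iff) (metis ln_exp ln_mono)
  then have "\<bar>?m * ln ?m\<bar> \<le> exp B * B"
    using 2 \<open>?m > 0\<close> by (auto simp: abs_mult intro!: mult_mono)
  then show ?thesis
    using 1 unfolding ent_exp_def by linarith
qed

text \<open>The lower half of the duality formula, in which Ent(f) is the supremum of E (f T) over T
  with E exp T at most 1. It is what turns a bound on an entropy of a marginal into a bound by
  averaged entropies.\<close>

lemma (in prob_space) ent_exp_variational:
  fixes W T :: "'a \<Rightarrow> real"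
  assumes W: "W \<in> borel_measurable M" "\<And>x. x \<in> space M \<Longrightarrow> \<bar>W x\<bar> \<le> B"
    and T: "T \<in> borel_measurable M" "\<And>x. x \<in> space M \<Longrightarrow> \<bar>T x\<bar> \<le> C"
    and le: "(\<integral>x. exp (T x) \<partial>M) \<le> 1"
  shows "(\<integral>x. exp (W x) * T x \<partial>M) \<le> ent_exp M W"
proof -
  define m where "m = (\<integral>x. exp (W x) \<partial>M)"
  have m: "m > 0"
    using integral_exp_bounds(1)[OF W] unfolding m_def by (meson exp_gt_zero less_le_trans)
  \<comment> \<open>The inequality 1 + u <= exp u at u = T x + ln m - W x, weighted by
    \<open>exp (W x)\<close>. The shift by ln m makes the left side integrate to the difference of
    the two sides of the claim, and the right side to m (E exp T - 1), which is at most 0.\<close>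
  have pw: "exp (W x) * T x + exp (W x) * ln m - exp (W x) * W x \<le> m * exp (T x) - exp (W x)" for x
  proof -
    have "1 + (T x + ln m - W x) \<le> exp (T x + ln m - W x)" by (rule exp_ge_add_one_self)
    then have "exp (W x) * (1 + (T x + ln m - W x)) \<le> exp (W x) * exp (T x + ln m - W x)"
      by (intro mult_left_mono) auto
    also have "\<dots> = m * exp (T x)" using m by (simp add: exp_add exp_diff)
    finally show ?thesis by (simp add: algebra_simps)
  qed
  note [simp] = integrable_exp_mult[OF W T] integrable_exp_mult[OF W W] integrable_exp_bounded[OF W]
    integrable_exp_bounded[OF T]
  have "(\<integral>x. exp (W x) * T x + exp (W x) * ln m - exp (W x) * W x \<partial>M)
      \<le> (\<integral>x. m * exp (T x) - exp (W x) \<partial>M)"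
    by (intro integral_mono pw) auto
  then have "(\<integral>x. exp (W x) * T x \<partial>M) + m * ln m - (\<integral>x. exp (W x) * W x \<partial>M)
      \<le> m * (\<integral>x. exp (T x) \<partial>M) - m"
    by (simp add: m_def)
  moreover have "m * (\<integral>x. exp (T x) \<partial>M) \<le> m * 1" using le m by (intro mult_left_mono) auto
  ultimately show ?thesis by (simp add: ent_exp_def m_def)
qed

text \<open>Chain rule for entropy: the joint entropy is the average over x of the entropy in y,
  plus the entropy of the marginal \<open>m\<close> of exp W. Only the marginal term has to be
  estimated. The left side is spelled out with iterated integrals because this is the form in which
  an integral over a product splits off one coordinate.\<close>

lemma ent_exp_pair_le:
  fixes W :: "'a \<Rightarrow> 'b \<Rightarrow> real"
  assumes "prob_space M1" "prob_space M2"
    and W[measurable]: "case_prod W \<in> borel_measurable (M1 \<Otimes>\<^sub>M M2)"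
    and B: "\<And>x y. x \<in> space M1 \<Longrightarrow> y \<in> space M2 \<Longrightarrow> \<bar>W x y\<bar> \<le> B"
  shows "(\<integral>x. \<integral>y. exp (W x y) * W x y \<partial>M2 \<partial>M1)
      - (\<integral>x. \<integral>y. exp (W x y) \<partial>M2 \<partial>M1) * ln (\<integral>x. \<integral>y. exp (W x y) \<partial>M2 \<partial>M1)
    \<le> (\<integral>x. ent_exp M2 (W x) \<partial>M1) + (\<integral>y. ent_exp M1 (\<lambda>x. W x y) \<partial>M2)"
proof -
  interpret M1: prob_space M1 by fact
  interpret M2: prob_space M2 by fact
  interpret pair_prob_space M1 M2 ..
  define m where "m x = (\<integral>y. exp (W x y) \<partial>M2)" for x
  define \<mu> where "\<mu> = (\<integral>x. m x \<partial>M1)"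
  \<comment> \<open>Testing each entropy in x against the logarithm T of the normalised marginal density of exp W
    bounds the entropy of that marginal by the average of the entropies in x.\<close>
  define T where "T x = ln (m x) - ln \<mu>" for x
  have m_meas[measurable]: "m \<in> borel_measurable M1" unfolding m_def by measurable
  have W1: "(\<lambda>y. W x y) \<in> borel_measurable M2" if "x \<in> space M1" for x
    using measurable_compose[OF measurable_Pair1'[OF that] W] by simp
  have W2: "(\<lambda>x. W x y) \<in> borel_measurable M1" if "y \<in> space M2" for y
    using measurable_compose[OF measurable_Pair2'[OF that] W] by simp
  have m: "exp (- B) \<le> m x" "m x \<le> exp B" if "x \<in> space M1" for x
    unfolding m_def using M2.integral_exp_bounds[OF W1[OF that] B[OF that]] by auto
  have m0: "m x > 0" if "x \<in> space M1" for x
    using m(1)[OF that] by (meson exp_gt_zero less_le_trans)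
  have lnm: "\<bar>ln (m x)\<bar> \<le> B" if "x \<in> space M1" for x
    using m[OF that] m0[OF that] by (simp add: abs_le_iff ln_ge_iff minus_le_iff) (metis ln_exp ln_mono)
  have im: "integrable M1 m"
    using m m0 by (intro M1.integrable_bounded[where B = "exp B"]) (auto simp: abs_le_iff less_imp_le order_trans[of _ 0])
  have "(\<integral>x. exp (- B) \<partial>M1) \<le> \<mu>"
    unfolding \<mu>_def using m by (intro integral_mono im) auto
  then have "exp (- B) \<le> \<mu>" by (simp add: M1.prob_space)
  then have \<mu>: "\<mu> > 0" by (meson exp_gt_zero less_le_trans)
  have T_meas[measurable]: "T \<in> borel_measurable M1" unfolding T_def by measurable
  have T: "\<bar>T x\<bar> \<le> B + \<bar>ln \<mu>\<bar>" if "x \<in> space M1" for x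
    using lnm[OF that] unfolding T_def by auto
  have "(\<integral>x. exp (T x) \<partial>M1) = (\<integral>x. m x / \<mu> \<partial>M1)"
    using m0 \<mu> by (intro Bochner_Integration.integral_cong) (auto simp: T_def exp_diff)
  also have "\<dots> = 1" using \<mu> by (simp add: \<mu>_def)
  finally have expT: "(\<integral>x. exp (T x) \<partial>M1) \<le> 1" by simp
  have bW: "\<bar>case_prod W z\<bar> \<le> B" if "z \<in> space (M1 \<Otimes>\<^sub>M M2)" for z
    using that B by (auto simp: space_pair_measure)
  have bT: "\<bar>T (fst z)\<bar> \<le> B + \<bar>ln \<mu>\<bar>" if "z \<in> space (M1 \<Otimes>\<^sub>M M2)" for z
    using that T by (auto simp: space_pair_measure)
  have iWT: "integrable (M1 \<Otimes>\<^sub>M M2) (\<lambda>(x,y). exp (W x y) * T x)"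
    using integrable_exp_mult[OF W bW _ bT] by (simp add: split_beta')
  have iWW: "integrable (M1 \<Otimes>\<^sub>M M2) (\<lambda>(x,y). exp (W x y) * W x y)"
    using integrable_exp_mult[OF W bW W bW] by (simp add: split_beta')
  have imln: "integrable M1 (\<lambda>x. m x * ln (m x))"
  proof (rule M1.integrable_bounded[where B = "exp B * B"])
    show "\<bar>m x * ln (m x)\<bar> \<le> exp B * B" if "x \<in> space M1" for x
      using m0[OF that] m(2)[OF that] lnm[OF that] by (auto simp: abs_mult intro!: mult_mono)
  qed auto
  have ient: "integrable M2 (\<lambda>y. ent_exp M1 (\<lambda>x. W x y))"
  proof (rule M2.integrable_bounded)
    show "(\<lambda>y. ent_exp M1 (\<lambda>x. W x y)) \<in> borel_measurable M2"
      unfolding ent_exp_def by measurable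
    show "\<bar>ent_exp M1 (\<lambda>x. W x y)\<bar> \<le> 2 * (exp B * B)" if "y \<in> space M2" for y
      by (rule M1.abs_ent_exp_le[OF W2[OF that] B[OF _ that]])
  qed
  have "(\<integral>x. m x * ln (m x) \<partial>M1) - \<mu> * ln \<mu> = (\<integral>x. m x * T x \<partial>M1)"
  proof -
    have "(\<integral>x. m x * T x \<partial>M1) = (\<integral>x. m x * ln (m x) - m x * ln \<mu> \<partial>M1)"
      by (simp add: T_def algebra_simps)
    also have "\<dots> = (\<integral>x. m x * ln (m x) \<partial>M1) - \<mu> * ln \<mu>"
      using imln im by (simp add: \<mu>_def)
    finally show ?thesis by simp
  qed
  also have "\<dots> = (\<integral>x. \<integral>y. exp (W x y) * T x \<partial>M2 \<partial>M1)"
    by (simp add: m_def)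
  also have "\<dots> = (\<integral>y. \<integral>x. exp (W x y) * T x \<partial>M1 \<partial>M2)"
    by (rule Fubini_integral[OF iWT, symmetric])
  also have "\<dots> \<le> (\<integral>y. ent_exp M1 (\<lambda>x. W x y) \<partial>M2)"
  proof (rule integral_mono)
    show "integrable M2 (\<lambda>y. \<integral>x. exp (W x y) * T x \<partial>M1)" by (rule integrable_snd[OF iWT])
    show "(\<integral>x. exp (W x y) * T x \<partial>M1) \<le> ent_exp M1 (\<lambda>x. W x y)" if "y \<in> space M2" for y
      by (rule M1.ent_exp_variational[OF W2[OF that] B[OF _ that] T_meas T expT])
  qed (rule ient)
  finally have *: "(\<integral>x. m x * ln (m x) \<partial>M1) - \<mu> * ln \<mu> \<le> (\<integral>y. ent_exp M1 (\<lambda>x. W x y) \<partial>M2)" .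
  \<comment> \<open>Averaging the entropies in y subtracts E (m ln m), which cancels the same term
    in the entropy of the marginal.\<close>
  have "(\<integral>x. ent_exp M2 (W x) \<partial>M1)
      = (\<integral>x. (\<integral>y. exp (W x y) * W x y \<partial>M2) - m x * ln (m x) \<partial>M1)"
    by (simp add: ent_exp_def m_def)
  also have "\<dots> = (\<integral>x. \<integral>y. exp (W x y) * W x y \<partial>M2 \<partial>M1) - (\<integral>x. m x * ln (m x) \<partial>M1)"
    using integrable_fst[OF iWW] imln by simp
  finally show ?thesis using * by (simp add: \<mu>_def m_def[symmetric])
qed

text \<open>Jensen replaces ln E exp W by the mean of W, which bounds the entropy by the double
  integral of \<open>exp (W x) * (W x - W y)\<close> over two independent points. Exchanging the
  points symmetrises this integrand, and the symmetric sum is controlled pointwise by squared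
  positive parts.\<close>

lemma (in prob_space) ent_exp_le:
  fixes W :: "'a \<Rightarrow> real"
  assumes W[measurable]: "W \<in> borel_measurable M" and B: "\<And>x. x \<in> space M \<Longrightarrow> \<bar>W x\<bar> \<le> B"
  shows "ent_exp M W \<le> (\<integral>x. exp (W x) * (\<integral>y. (max 0 (W x - W y))\<^sup>2 \<partial>M) \<partial>M)"
proof -
  define m where "m = (\<integral>x. exp (W x) \<partial>M)"
  define c where "c = (\<integral>x. W x \<partial>M)"
  have iW: "integrable M W" using integrable_bounded[OF W B] .
  note i = iW integrable_exp_bounded[OF W B] integrable_exp_mult[OF W B W B]
  note M1 = prob_space
  interpret pair_prob_space M M ..
  \<comment> \<open>Jensen's inequality, from the tangent line of exp at the mean
    \<open>c\<close>.\<close>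
  have "exp c \<le> m"
  proof -
    have "(\<integral>x. exp c * (1 + (W x - c)) \<partial>M) \<le> (\<integral>x. exp (W x) \<partial>M)"
    proof (rule integral_mono)
      fix x
      have "exp c * (1 + (W x - c)) \<le> exp c * exp (W x - c)"
        by (intro mult_left_mono exp_ge_add_one_self) auto
      then show "exp c * (1 + (W x - c)) \<le> exp (W x)" by (simp add: exp_diff)
    qed (use i in auto)
    also have "(\<integral>x. exp c * (1 + (W x - c)) \<partial>M) = exp c"
      using i by (simp add: M1 c_def)
    finally show ?thesis by (simp add: m_def)
  qed
  then have m: "m > 0" "c \<le> ln m"
    by (meson exp_gt_zero less_le_trans) (use \<open>exp c \<le> m\<close> in \<open>metis exp_gt_zero less_le_trans ln_ge_iff\<close>)
  let ?g = "\<lambda>x y. exp (W x) * (max 0 (W x - W y))\<^sup>2"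
  have bnd: "\<bar>exp (W x) * (max 0 (W x - W y))\<^sup>2\<bar> \<le> exp B * (2 * B)\<^sup>2" if "x \<in> space M" "y \<in> space M" for x y
  proof -
    have "0 \<le> max 0 (W x - W y)" "max 0 (W x - W y) \<le> 2 * B"
      using B[OF that(1)] B[OF that(2)] by auto
    then have "(max 0 (W x - W y))\<^sup>2 \<le> (2 * B)\<^sup>2" by (intro power_mono)
    then show ?thesis using B[OF that(1)] unfolding abs_mult by (intro mult_mono) auto
  qed
  have ig: "integrable (M \<Otimes>\<^sub>M M) (\<lambda>(x,y). ?g x y)"
    using bnd by (intro P.integrable_bounded[where B = "exp B * (2 * B)\<^sup>2"]) (auto simp: space_pair_measure)
  have bnd2: "\<bar>exp (W x) * (W x - W y)\<bar> \<le> exp B * (2 * B)" if "x \<in> space M" "y \<in> space M" for x y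
    using B[OF that(1)] B[OF that(2)] unfolding abs_mult by (intro mult_mono) (auto simp: abs_le_iff)
  have ih: "integrable (M \<Otimes>\<^sub>M M) (\<lambda>(x,y). exp (W x) * (W x - W y))"
    using bnd2 by (intro P.integrable_bounded[where B = "exp B * (2 * B)"]) (auto simp: space_pair_measure)
  have sg: "(\<integral>(x,y). ?g y x \<partial>(M \<Otimes>\<^sub>M M)) = (\<integral>(x,y). ?g x y \<partial>(M \<Otimes>\<^sub>M M))" 
    and ig': "integrable (M \<Otimes>\<^sub>M M) (\<lambda>(x,y). ?g y x)"
    using integral_product_swap[of "\<lambda>(x,y). ?g x y"] integrable_product_swap[OF ig] by auto
  have sh: "(\<integral>(x,y). exp (W y) * (W y - W x) \<partial>(M \<Otimes>\<^sub>M M)) = (\<integral>(x,y). exp (W x) * (W x - W y) \<partial>(M \<Otimes>\<^sub>M M))" 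
    and ih': "integrable (M \<Otimes>\<^sub>M M) (\<lambda>(x,y). exp (W y) * (W y - W x))"
    using integral_product_swap[of "\<lambda>(x,y). exp (W x) * (W x - W y)"] integrable_product_swap[OF ih] by auto
  \<comment> \<open>On the right only the term with the larger exponent survives. For v <= u the
    left side is (exp u - exp v) (u - v), and the tangent of exp at u gives exp u - exp v <= exp u
    (u - v).\<close>
  have pw: "exp u * (u - v) + exp v * (v - u)
      \<le> exp u * (max 0 (u - v))\<^sup>2 + exp v * (max 0 (v - u))\<^sup>2" for u v :: real
  proof -
    have *: "exp u * (u - v) + exp v * (v - u) \<le> exp u * (u - v)\<^sup>2" if "v \<le> u" for u v :: real
    proof -
      have "1 + (v - u) \<le> exp (v - u)" by (rule exp_ge_add_one_self)
      then have "exp u * (1 + (v - u)) \<le> exp v" 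
        using mult_left_mono[of "1 + (v - u)" "exp (v - u)" "exp u"] by (simp add: exp_diff)
      then have "(exp u - exp v) * (u - v) \<le> (exp u * (u - v)) * (u - v)"
        using that by (intro mult_right_mono) (auto simp: algebra_simps)
      then show ?thesis by (simp add: algebra_simps power2_eq_square)
    qed
    show ?thesis using *[of v u] *[of u v] by (cases "v \<le> u") (auto simp: max_def)
  qed
  have "ent_exp M W \<le> (\<integral>x. exp (W x) * W x \<partial>M) - m * c"
    using m by (simp add: ent_exp_def m_def[symmetric] mult_left_mono)
  also have "\<dots> = (\<integral>x. exp (W x) * W x - exp (W x) * c \<partial>M)"
    using i by (simp add: m_def)
  also have "\<dots> = (\<integral>x. \<integral>y. exp (W x) * (W x - W y) \<partial>M \<partial>M)"
    using i by (simp add: c_def M1 algebra_simps)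
  also have "\<dots> = (\<integral>(x,y). exp (W x) * (W x - W y) \<partial>(M \<Otimes>\<^sub>M M))"
    by (rule integral_fst[OF ih])
  \<comment> \<open>The integral is doubled in order to add the copy with x and y exchanged:
    \<open>pw\<close> holds for the sum of the two terms, not for each one, since u - v exceeds its
    square when it lies strictly between 0 and 1.\<close>
  also have "2 * \<dots> = (\<integral>z. (\<lambda>(x,y). exp (W x) * (W x - W y)) z + (\<lambda>(x,y). exp (W y) * (W y - W x)) z \<partial>(M \<Otimes>\<^sub>M M))"
    using ih ih' sh by (subst Bochner_Integration.integral_add) auto
  also have "\<dots> \<le> (\<integral>z. (\<lambda>(x,y). ?g x y) z + (\<lambda>(x,y). ?g y x) z \<partial>(M \<Otimes>\<^sub>M M))"
    using ih ih' ig ig' pw by (intro integral_mono Bochner_Integration.integrable_add) auto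
  also have "\<dots> = 2 * (\<integral>(x,y). ?g x y \<partial>(M \<Otimes>\<^sub>M M))"
    using ig ig' sg by (subst Bochner_Integration.integral_add) auto
  also have "(\<integral>(x,y). ?g x y \<partial>(M \<Otimes>\<^sub>M M)) = (\<integral>x. \<integral>y. ?g x y \<partial>M \<partial>M)"
    by (rule integral_fst[OF ig, symmetric])
  finally show ?thesis by simp
qed

section \<open>Tensorization\<close>

lemma measurable_fun_upd_PiM:
  assumes "i \<in> I" 
  shows "(\<lambda>(w, y). w(i := y)) \<in> measurable (PiM I M \<Otimes>\<^sub>M M i) (PiM I M)"
  using measurable_add_dim[of i I M] assms by (simp add: insert_absorb)

lemma space_PiM_upd:
  "w \<in> space (PiM I M) \<Longrightarrow> y \<in> space (M i) \<Longrightarrow> w(i := y) \<in> space (PiM (insert i I) M)"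
  by (auto simp: space_PiM PiE_def extensional_def)

lemma space_PiM_upd_mem:
  "i \<in> I \<Longrightarrow> w \<in> space (PiM I M) \<Longrightarrow> y \<in> space (M i) \<Longrightarrow> w(i := y) \<in> space (PiM I M)"
  using space_PiM_upd[of w I M y i] by (simp add: insert_absorb)

text \<open>Replacing coordinate i by an independent draw from \<open>M i\<close> preserves the
  product law. Once coordinate i is split off, its old value y' is overwritten at once and
  integrates out to 1.\<close>

lemma integral_PiM_resample:
  fixes \<phi> :: "_ \<Rightarrow> real"
  assumes "\<And>i. prob_space (M i)" "finite I" "i \<in> I"
    and \<phi>: "\<phi> \<in> borel_measurable (PiM I M)" "\<And>w. w \<in> space (PiM I M) \<Longrightarrow> \<bar>\<phi> w\<bar> \<le> B"
  shows "(\<integral>w. \<integral>y. \<phi> (w(i := y)) \<partial>M i \<partial>PiM I M) = (\<integral>w. \<phi> w \<partial>PiM I M)"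
proof -
  interpret product_sigma_finite M
    by unfold_locales (metis assms(1) prob_space_imp_sigma_finite sigma_finite_measure.sigma_finite_countable)
  interpret Mi: prob_space "M i" by (rule assms(1))
  interpret PI: prob_space "PiM I M" by (intro prob_space_PiM assms(1))
  define J where "J = I - {i}"
  have I: "I = insert i J" "finite J" "i \<notin> J" using assms(2,3) by (auto simp: J_def)
  have "(\<lambda>(w, y). \<phi> (w(i := y))) \<in> borel_measurable (PiM I M \<Otimes>\<^sub>M M i)"
    using measurable_compose[OF measurable_fun_upd_PiM[OF \<open>i \<in> I\<close>, of M] \<phi>(1)] by (simp add: split_beta')
  then have meas[measurable]: "(\<lambda>w. \<integral>y. \<phi> (w(i := y)) \<partial>M i) \<in> borel_measurable (PiM I M)"
    by measurable
  have "\<bar>\<integral>y. \<phi> (w(i := y)) \<partial>M i\<bar> \<le> B" if "w \<in> space (PiM I M)" for w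
  proof (rule Mi.abs_integral_le)
    show "(\<lambda>y. \<phi> (w(i := y))) \<in> borel_measurable (M i)"
      using measurable_compose[OF measurable_Pair1'[OF that] \<open>(\<lambda>(w, y). \<phi> (w(i := y))) \<in> _\<close>] by simp
    show "AE y in M i. \<bar>\<phi> (w(i := y))\<bar> \<le> B"
      using space_PiM_upd_mem[OF assms(3) that] \<phi>(2) by (intro AE_I2) auto
  qed
  then have "integrable (PiM I M) (\<lambda>w. \<integral>y. \<phi> (w(i := y)) \<partial>M i)"
    by (intro PI.integrable_bounded) auto
  then have "(\<integral>w. \<integral>y. \<phi> (w(i := y)) \<partial>M i \<partial>PiM I M)
      = (\<integral>w. \<integral>y'. \<integral>y. \<phi> (w(i := y', i := y)) \<partial>M i \<partial>M i \<partial>PiM J M)"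
    unfolding I(1) by (rule product_integral_insert[OF I(2,3)])
  also have "\<dots> = (\<integral>w. \<integral>y. \<phi> (w(i := y)) \<partial>M i \<partial>PiM J M)"
    by (simp add: Mi.prob_space)
  also have "\<dots> = (\<integral>w. \<phi> w \<partial>PiM I M)"
    unfolding I(1) using PI.integrable_bounded[OF \<phi>] unfolding I(1)
    by (intro product_integral_insert[OF I(2,3), symmetric])
  finally show ?thesis .
qed

lemma borel_measurable_ent_exp_upd:
  fixes W :: "_ \<Rightarrow> real"
  assumes "prob_space (M i)" "i \<in> I" and W[measurable]: "W \<in> borel_measurable (PiM I M)"
  shows "(\<lambda>w. ent_exp (M i) (\<lambda>y. W (w(i := y)))) \<in> borel_measurable (PiM I M)"
proof -
  interpret prob_space "M i" by fact
  have [measurable]: "(\<lambda>(w, y). W (w(i := y))) \<in> borel_measurable (PiM I M \<Otimes>\<^sub>M M i)"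
    using measurable_compose[OF measurable_fun_upd_PiM[OF assms(2)] W] by (simp add: split_beta')
  show ?thesis unfolding ent_exp_def by measurable
qed

lemma borel_measurable_PiM_upd:
  assumes "i \<in> I" "w \<in> space (PiM I M)" "W \<in> borel_measurable (PiM I M)"
  shows "(\<lambda>y. W (w(i := y))) \<in> borel_measurable (M i)"
  using measurable_compose[OF measurable_Pair1'[OF assms(2)] measurable_compose[OF measurable_fun_upd_PiM[OF assms(1)] assms(3)]]
  by simp

text \<open>Induction on the index set: the two-factor inequality separates the new coordinate i
  from the rest, and the induction hypothesis is applied to the section of \<open>W\<close> at each
  fixed value y of that coordinate. Hence the induction is over all \<open>W\<close>.\<close>

lemma ent_exp_PiM_le_sum:
  fixes W :: "('i \<Rightarrow> 'a) \<Rightarrow> real"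
  assumes M: "\<And>i. prob_space (M i)" and "finite I"
    and "W \<in> borel_measurable (PiM I M)" "\<And>w. w \<in> space (PiM I M) \<Longrightarrow> \<bar>W w\<bar> \<le> B"
  shows "ent_exp (PiM I M) W \<le> (\<Sum>i\<in>I. \<integral>w. ent_exp (M i) (\<lambda>y. W (w(i := y))) \<partial>PiM I M)"
  using assms(2-)
proof (induction I arbitrary: W)
  \<comment> \<open>The empty product is one point of mass 1, and the entropy of a constant is
    0.\<close>
  case empty
  then show ?case by (simp add: ent_exp_def PiM_empty lebesgue_integral_count_space_finite)
next
  case (insert i I W)
  let ?J = "insert i I"
  interpret product_sigma_finite M
    by unfold_locales (metis assms(1) prob_space_imp_sigma_finite sigma_finite_measure.sigma_finite_countable)
  interpret Mi: prob_space "M i" by (rule M)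
  interpret PI: prob_space "PiM I M" by (intro prob_space_PiM M)
  interpret PJ: prob_space "PiM ?J M" by (intro prob_space_PiM M)
  interpret pair_prob_space "PiM I M" "M i" ..
  note W = insert.prems
  define E where "E k w = ent_exp (M k) (\<lambda>y. W (w(k := y)))" for k w
  have Em[measurable]: "E k \<in> borel_measurable (PiM ?J M)" if "k \<in> ?J" for k
    unfolding E_def using borel_measurable_ent_exp_upd[OF M that W(1)] .
  have Eb: "\<bar>E k w\<bar> \<le> 2 * (exp B * B)" if "k \<in> ?J" "w \<in> space (PiM ?J M)" for k w
  proof -
    interpret Mk: prob_space "M k" by (rule M)
    show ?thesis unfolding E_def
      using space_PiM_upd_mem[OF that] W(2)
      by (intro Mk.abs_ent_exp_le borel_measurable_PiM_upd[OF that W(1)]) auto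
  qed
  have upd: "(\<lambda>(x, y). x(i := y)) \<in> measurable (PiM I M \<Otimes>\<^sub>M M i) (PiM ?J M)"
    by (rule measurable_add_dim)
  have upd': "(\<lambda>x. x(i := y)) \<in> measurable (PiM I M) (PiM ?J M)" if "y \<in> space (M i)" for y
    using measurable_compose[OF measurable_Pair2'[OF that] upd] by simp
  have EI: "(\<integral>w. E k w \<partial>PiM ?J M) = (\<integral>x. \<integral>y. E k (x(i := y)) \<partial>M i \<partial>PiM I M)" if "k \<in> ?J" for k
    using Em[OF that] Eb[OF that] insert.hyps
    by (intro product_integral_insert PJ.integrable_bounded) auto
  have intE: "integrable (PiM I M \<Otimes>\<^sub>M M i) (\<lambda>(x, y). E k (x(i := y)))" if "k \<in> ?J" for k
    using measurable_compose[OF upd Em[OF that]] Eb[OF that] space_PiM_upd[of _ I M]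
    by (intro P.integrable_bounded[where B = "2 * (exp B * B)"]) (auto simp: space_pair_measure split_beta')
  have mW: "(\<lambda>(x, y). W (x(i := y))) \<in> borel_measurable (PiM I M \<Otimes>\<^sub>M M i)"
    using measurable_compose[OF upd W(1)] by (simp add: split_beta' fun_upd_def)
  have bW: "\<bar>W (x(i := y))\<bar> \<le> B" if "x \<in> space (PiM I M)" "y \<in> space (M i)" for x y
    using W(2) space_PiM_upd[OF that] by auto
  have "ent_exp (PiM ?J M) W = (\<integral>x. \<integral>y. exp (W (x(i := y))) * W (x(i := y)) \<partial>M i \<partial>PiM I M)
      - (\<integral>x. \<integral>y. exp (W (x(i := y))) \<partial>M i \<partial>PiM I M) * ln (\<integral>x. \<integral>y. exp (W (x(i := y))) \<partial>M i \<partial>PiM I M)"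
    unfolding ent_exp_def
    using product_integral_insert[OF insert.hyps(1,2) PJ.integrable_exp_bounded[OF W]]
      product_integral_insert[OF insert.hyps(1,2) PJ.integrable_exp_mult[OF W W]] by (simp add: fun_upd_def)
  also have "\<dots> \<le> (\<integral>x. ent_exp (M i) (\<lambda>y. W (x(i := y))) \<partial>PiM I M)
      + (\<integral>y. ent_exp (PiM I M) (\<lambda>x. W (x(i := y))) \<partial>M i)"
    by (rule ent_exp_pair_le[OF PI.prob_space_axioms Mi.prob_space_axioms mW bW])
  \<comment> \<open>\<open>E i\<close> overwrites coordinate i, so the integral over that coordinate
    is the integral of a constant.\<close>
  also have "(\<integral>x. ent_exp (M i) (\<lambda>y. W (x(i := y))) \<partial>PiM I M) = (\<integral>w. E i w \<partial>PiM ?J M)"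
    by (subst EI) (auto simp: E_def Mi.prob_space)
  also have "(\<integral>y. ent_exp (PiM I M) (\<lambda>x. W (x(i := y))) \<partial>M i)
      \<le> (\<integral>y. (\<Sum>k\<in>I. \<integral>x. E k (x(i := y)) \<partial>PiM I M) \<partial>M i)"
  proof (rule integral_mono)
    show "integrable (M i) (\<lambda>y. ent_exp (PiM I M) (\<lambda>x. W (x(i := y))))"
    proof (rule Mi.integrable_bounded)
      show "(\<lambda>y. ent_exp (PiM I M) (\<lambda>x. W (x(i := y)))) \<in> borel_measurable (M i)"
        unfolding ent_exp_def using mW by measurable
      show "\<bar>ent_exp (PiM I M) (\<lambda>x. W (x(i := y)))\<bar> \<le> 2 * (exp B * B)" if "y \<in> space (M i)" for y
        by (rule PI.abs_ent_exp_le[OF measurable_compose[OF upd'[OF that] W(1)] bW[OF _ that]])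
    qed
    show "integrable (M i) (\<lambda>y. \<Sum>k\<in>I. \<integral>x. E k (x(i := y)) \<partial>PiM I M)"
      using intE by (intro Bochner_Integration.integrable_sum integrable_snd) auto
    fix y assume y: "y \<in> space (M i)"
    have "ent_exp (PiM I M) (\<lambda>x. W (x(i := y)))
        \<le> (\<Sum>k\<in>I. \<integral>x. ent_exp (M k) (\<lambda>z. W ((x(k := z))(i := y))) \<partial>PiM I M)"
      by (rule insert.IH[OF measurable_compose[OF upd'[OF y] W(1)] bW[OF _ y]])
    also have "\<dots> = (\<Sum>k\<in>I. \<integral>x. E k (x(i := y)) \<partial>PiM I M)"
    proof (rule sum.cong)
      fix k assume "k \<in> I"
      then have "k \<noteq> i" using insert.hyps by auto
      then show "(\<integral>x. ent_exp (M k) (\<lambda>z. W ((x(k := z))(i := y))) \<partial>PiM I M) = (\<integral>x. E k (x(i := y)) \<partial>PiM I M)"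
        by (simp add: E_def fun_upd_twist)
    qed simp
    finally show "ent_exp (PiM I M) (\<lambda>x. W (x(i := y))) \<le> (\<Sum>k\<in>I. \<integral>x. E k (x(i := y)) \<partial>PiM I M)" .
  qed
  also have "\<dots> = (\<Sum>k\<in>I. \<integral>y. \<integral>x. E k (x(i := y)) \<partial>PiM I M \<partial>M i)"
    using intE by (intro Bochner_Integration.integral_sum integrable_snd) auto
  also have "\<dots> = (\<Sum>k\<in>I. \<integral>w. E k w \<partial>PiM ?J M)"
    using intE EI by (intro sum.cong refl) (simp add: Fubini_integral)
  finally show ?case
    using insert.hyps by (simp add: E_def fun_upd_def)
qed

text \<open>The one-variable inequality is applied in each coordinate separately. It leaves an
  integrand evaluated at \<open>w(i := y)\<close> with y a fresh draw, and invariance under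
  resampling returns it to \<open>w\<close>.\<close>

lemma ent_exp_PiM_le:
  fixes W :: "('i \<Rightarrow> 'a) \<Rightarrow> real"
  assumes M: "\<And>i. prob_space (M i)" and "finite I"
    and W: "W \<in> borel_measurable (PiM I M)" "\<And>w. w \<in> space (PiM I M) \<Longrightarrow> \<bar>W w\<bar> \<le> B"
  shows "ent_exp (PiM I M) W
    \<le> (\<integral>w. exp (W w) * (\<Sum>i\<in>I. \<integral>y. (max 0 (W w - W (w(i := y))))\<^sup>2 \<partial>M i) \<partial>PiM I M)"
proof -
  interpret PI: prob_space "PiM I M" by (intro prob_space_PiM M)
  define V where "V i w = (\<integral>y. (max 0 (W w - W (w(i := y))))\<^sup>2 \<partial>M i)" for i w
  have sq: "(max 0 (a - b))\<^sup>2 \<le> 4 * B\<^sup>2" if "\<bar>a\<bar> \<le> B" "\<bar>b\<bar> \<le> B" for a b :: real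
    using that power_mono[of "max 0 (a - b)" "2 * B" 2] by auto
  note upd = space_PiM_upd_mem[of _ I _ M]
  have Vm: "V i \<in> borel_measurable (PiM I M)" if "i \<in> I" for i
  proof -
    interpret Mi: prob_space "M i" by (rule M)
    have [measurable]: "(\<lambda>(w, y). W (w(i := y))) \<in> borel_measurable (PiM I M \<Otimes>\<^sub>M M i)"
      using measurable_compose[OF measurable_fun_upd_PiM[OF that] W(1)] by (simp add: split_beta')
    note [measurable] = W(1)
    show ?thesis unfolding V_def by measurable
  qed
  have Vb: "\<bar>V i w\<bar> \<le> (4 * B\<^sup>2)" if "i \<in> I" "w \<in> space (PiM I M)" for i w
  proof -
    interpret Mi: prob_space "M i" by (rule M)
    show ?thesis unfolding V_def
      using borel_measurable_PiM_upd[OF that W(1)] W(2) upd that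
      by (intro Mi.abs_integral_le AE_I2) (auto intro!: sq)
  qed
  have "ent_exp (PiM I M) W \<le> (\<Sum>i\<in>I. \<integral>w. ent_exp (M i) (\<lambda>y. W (w(i := y))) \<partial>PiM I M)"
    by (rule ent_exp_PiM_le_sum[OF M \<open>finite I\<close> W])
  also have "\<dots> \<le> (\<Sum>i\<in>I. \<integral>w. exp (W w) * V i w \<partial>PiM I M)"
  proof (rule sum_mono)
    fix i assume i: "i \<in> I"
    interpret Mi: prob_space "M i" by (rule M)
    have iV: "integrable (PiM I M) (\<lambda>w. exp (W w) * V i w)"
      by (rule PI.integrable_exp_mult[OF W Vm[OF i] Vb[OF i]])
    have bV: "\<bar>exp (W w) * V i w\<bar> \<le> exp B * (4 * B\<^sup>2)" if "w \<in> space (PiM I M)" for w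
      using W(2)[OF that] Vb[OF i that] unfolding abs_mult by (intro mult_mono) auto
    \<comment> \<open>The second update at i overrides the first, so y enters only through the
      leading term; this is the shape of the one-variable bound.\<close>
    have Vupd: "V i (w(i := y)) = (\<integral>z. (max 0 (W (w(i := y)) - W (w(i := z))))\<^sup>2 \<partial>M i)" for w y
      by (simp add: V_def)
    have mexpV: "(\<lambda>w. exp (W w) * V i w) \<in> borel_measurable (PiM I M)"
      using W(1) Vm[OF i] by simp
    have mint: "(\<lambda>w. \<integral>y. exp (W (w(i := y))) * V i (w(i := y)) \<partial>M i) \<in> borel_measurable (PiM I M)"
      using measurable_compose[OF measurable_fun_upd_PiM[OF i] mexpV]
      by (intro Mi.borel_measurable_lebesgue_integral) (simp add: split_beta')
    have "(\<integral>w. ent_exp (M i) (\<lambda>y. W (w(i := y))) \<partial>PiM I M)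
        \<le> (\<integral>w. \<integral>y. exp (W (w(i := y))) * V i (w(i := y)) \<partial>M i \<partial>PiM I M)"
    proof (rule integral_mono)
      show "integrable (PiM I M) (\<lambda>w. ent_exp (M i) (\<lambda>y. W (w(i := y))))"
        using W(2) upd[OF i] i
        by (intro PI.integrable_bounded[where B = "2 * (exp B * B)"] borel_measurable_ent_exp_upd[OF M i] W(1)
            Mi.abs_ent_exp_le borel_measurable_PiM_upd[OF i _ W(1)]) auto
      show "integrable (PiM I M) (\<lambda>w. \<integral>y. exp (W (w(i := y))) * V i (w(i := y)) \<partial>M i)"
        using bV upd[OF i]
        by (intro PI.integrable_bounded[OF mint] Mi.abs_integral_le AE_I2 
            borel_measurable_PiM_upd[OF i _ mexpV]) auto
      show "ent_exp (M i) (\<lambda>y. W (w(i := y))) \<le> (\<integral>y. exp (W (w(i := y))) * V i (w(i := y)) \<partial>M i)"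
        if "w \<in> space (PiM I M)" for w
        unfolding Vupd using upd[OF i that] W(2)
        by (intro Mi.ent_exp_le borel_measurable_PiM_upd[OF i that W(1)]) auto
    qed
    also have "\<dots> = (\<integral>w. exp (W w) * V i w \<partial>PiM I M)"
      by (rule integral_PiM_resample[OF M \<open>finite I\<close> i mexpV bV])
    finally show "(\<integral>w. ent_exp (M i) (\<lambda>y. W (w(i := y))) \<partial>PiM I M) \<le> (\<integral>w. exp (W w) * V i w \<partial>PiM I M)" .
  qed
  also have "\<dots> = (\<integral>w. exp (W w) * (\<Sum>i\<in>I. V i w) \<partial>PiM I M)"
    using PI.integrable_exp_mult[OF W Vm Vb]
    by (simp add: sum_distrib_left)
  finally show ?thesis by (simp add: V_def)
qed

section \<open>The Herbst argument\<close>

text \<open>A crude second-order remainder, uniform for bounded u, for differentiating under the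
  integral. Both signs of u start from exp u - 1 <= u exp u, which is 1 - u <= exp (-u).\<close>

lemma abs_exp_minus_one_minus_le: "\<bar>exp u - 1 - u\<bar> \<le> u\<^sup>2 * exp \<bar>u\<bar>" for u :: real
proof -
  have low: "0 \<le> exp u - 1 - u" using exp_ge_add_one_self[of u] by linarith
  have "exp u * (1 - u) \<le> exp u * exp (- u)"
    using exp_ge_add_one_self[of "- u"] by (intro mult_left_mono) auto
  then have up: "exp u - 1 \<le> u * exp u" by (simp add: exp_minus algebra_simps)
  have "exp u - 1 - u \<le> u\<^sup>2 * exp \<bar>u\<bar>"
  proof (cases "0 \<le> u")
    case True
    have "exp u - 1 - u \<le> u * (exp u - 1)" using up by (simp add: algebra_simps)
    also have "\<dots> \<le> u * (u * exp u)" using up True by (intro mult_left_mono)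
    finally show ?thesis using True by (simp add: power2_eq_square mult.assoc)
  next
    case False
    have "exp u - 1 - u \<le> u * (exp u - 1)" using up by (simp add: algebra_simps)
    also have "\<dots> \<le> u * u" using low False by (intro mult_left_mono_neg) auto
    also have "\<dots> \<le> u\<^sup>2 * exp \<bar>u\<bar>" by (simp add: power2_eq_square mult_le_cancel_left1)
    finally show ?thesis .
  qed
  then show ?thesis using low by simp
qed

lemma (in prob_space) DERIV_integral_exp:
  fixes Z :: "'a \<Rightarrow> real"
  assumes Z[measurable]: "Z \<in> borel_measurable M" and B: "\<And>x. x \<in> space M \<Longrightarrow> \<bar>Z x\<bar> \<le> B"
  shows "((\<lambda>t. \<integral>x. exp (t * Z x) \<partial>M) has_real_derivative (\<integral>x. exp (t * Z x) * Z x \<partial>M)) (at t)"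
proof -
  define F where "F t = (\<integral>x. exp (t * Z x) \<partial>M)" for t
  define F' where "F' = (\<integral>x. exp (t * Z x) * Z x \<partial>M)"
  \<comment> \<open>For |h| <= 1 the remainder at h * Z x is at most h^2 B^2 exp B, and the factor
    \<open>exp (t * Z x)\<close> is at most exp (|t| B). So \<open>K * \<bar>h\<bar>\<close> bounds
    the error of the difference quotient.\<close>
  define K where "K = exp (\<bar>t\<bar> * B) * (B\<^sup>2 * exp B)"
  have bt: "\<bar>s * Z x\<bar> \<le> \<bar>s\<bar> * B" if "x \<in> space M" for s x
    using B[OF that] by (simp add: abs_mult mult_left_mono)
  have i1: "integrable M (\<lambda>x. exp (s * Z x))" for s
    by (rule integrable_exp_bounded[OF _ bt]) measurable
  have i2: "integrable M (\<lambda>x. exp (s * Z x) * Z x)" for s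
    by (rule integrable_exp_mult[OF _ bt Z B]) measurable
  have bound: "\<bar>(F (t + h) - F t) / h - F'\<bar> \<le> K * \<bar>h\<bar>" if h: "h \<noteq> 0" "\<bar>h\<bar> \<le> 1" for h
  proof -
    have "\<bar>\<integral>x. exp ((t + h) * Z x) - exp (t * Z x) - h * (exp (t * Z x) * Z x) \<partial>M\<bar> \<le> K * h\<^sup>2"
    proof (rule abs_integral_le, measurable, rule AE_I2)
      fix x assume x: "x \<in> space M"
      have hZ: "\<bar>h * Z x\<bar> \<le> B" using bt[OF x, of h] mult_right_mono[OF h(2) order_trans[OF abs_ge_zero B[OF x]]] by simp
      have "\<bar>exp ((t + h) * Z x) - exp (t * Z x) - h * (exp (t * Z x) * Z x)\<bar>
          = \<bar>exp (t * Z x) * (exp (h * Z x) - 1 - h * Z x)\<bar>"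
        by (simp add: exp_add algebra_simps)
      also have "\<dots> = exp (t * Z x) * \<bar>exp (h * Z x) - 1 - h * Z x\<bar>" by (simp add: abs_mult)
      also have "\<dots> \<le> exp (\<bar>t\<bar> * B) * ((h * Z x)\<^sup>2 * exp \<bar>h * Z x\<bar>)"
        using bt[OF x, of t] by (intro mult_mono abs_exp_minus_one_minus_le) auto
      also have "\<dots> \<le> exp (\<bar>t\<bar> * B) * ((h\<^sup>2 * B\<^sup>2) * exp B)"
        using hZ B[OF x] abs_le_square_iff[of "Z x" B]
        by (intro mult_left_mono mult_mono) (auto simp: power_mult_distrib mult_left_mono)
      finally show "\<bar>exp ((t + h) * Z x) - exp (t * Z x) - h * (exp (t * Z x) * Z x)\<bar> \<le> K * h\<^sup>2"
        by (simp add: K_def mult_ac)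
    qed
    also have "(\<integral>x. exp ((t + h) * Z x) - exp (t * Z x) - h * (exp (t * Z x) * Z x) \<partial>M)
        = F (t + h) - F t - h * F'"
      using i1 i2 by (simp add: F_def F'_def)
    finally have "\<bar>F (t + h) - F t - h * F'\<bar> / \<bar>h\<bar> \<le> K * h\<^sup>2 / \<bar>h\<bar>" 
      by (intro divide_right_mono) auto
    moreover have "\<bar>F (t + h) - F t - h * F'\<bar> / \<bar>h\<bar> = \<bar>(F (t + h) - F t) / h - F'\<bar>"
      using h(1) by (simp add: abs_divide[symmetric] diff_divide_distrib)
    moreover have "K * h\<^sup>2 / \<bar>h\<bar> = K * \<bar>h\<bar>"
    proof -
      have "h\<^sup>2 / \<bar>h\<bar> = \<bar>h\<bar>" using h(1) by (simp add: divide_eq_eq power2_eq_square)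
      then show ?thesis by (metis times_divide_eq_right)
    qed
    ultimately show ?thesis by simp
  qed
  have "((\<lambda>h. (F (t + h) - F t) / h - F') \<longlongrightarrow> 0) (at 0)"
  proof (rule Lim_null_comparison)
    show "\<forall>\<^sub>F h in at 0. norm ((F (t + h) - F t) / h - F') \<le> K * \<bar>h\<bar>"
      using bound unfolding eventually_at by (intro exI[of _ 1]) (auto simp: dist_real_def)
    have "((\<lambda>h. K * \<bar>h\<bar>) \<longlongrightarrow> K * \<bar>0\<bar>) (at (0::real))" by (intro tendsto_intros)
    then show "((\<lambda>h. K * \<bar>h\<bar>) \<longlongrightarrow> 0) (at (0::real))" by simp
  qed
  then have "((\<lambda>h. (F (t + h) - F t) / h) \<longlongrightarrow> F') (at 0)" by (rule LIM_zero_cancel)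
  then show ?thesis unfolding DERIV_def F_def F'_def .
qed

text \<open>Herbst's argument. With L = ln F, the entropy hypothesis divided by t^2 F(t) says that
  the derivative of L(t) / t is at most a L'(t). Hence L(t) / t - a L(t) is nonincreasing, and its
  value at l is at most its limit at 0 from the right, the mean of Z.\<close>

lemma (in prob_space) ln_integral_exp_le_of_ent_exp_le:
  fixes Z :: "'a \<Rightarrow> real"
  assumes Z[measurable]: "Z \<in> borel_measurable M" and B: "\<And>x. x \<in> space M \<Longrightarrow> \<bar>Z x\<bar> \<le> B"
    and l: "0 < l" "a * l < 1"
    and ent: "\<And>t. 0 < t \<Longrightarrow> t \<le> l
      \<Longrightarrow> ent_exp M (\<lambda>x. t * Z x) \<le> a * t\<^sup>2 * (\<integral>x. exp (t * Z x) * Z x \<partial>M)"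
  shows "ln (\<integral>x. exp (l * (Z x - (\<integral>x. Z x \<partial>M))) \<partial>M) \<le> a * l\<^sup>2 * (\<integral>x. Z x \<partial>M) / (1 - a * l)"
proof -
  define F where "F t = (\<integral>x. exp (t * Z x) \<partial>M)" for t
  define F' where "F' t = (\<integral>x. exp (t * Z x) * Z x \<partial>M)" for t
  define E where "E = (\<integral>x. Z x \<partial>M)"
  define K where "K t = ln (F t) / t - a * ln (F t)" for t
  have bt: "\<bar>s * Z x\<bar> \<le> \<bar>s\<bar> * B" if "x \<in> space M" for s x
    using B[OF that] by (simp add: abs_mult mult_left_mono)
  have F: "F t > 0" for t
    unfolding F_def by (rule less_le_trans[OF exp_gt_zero integral_exp_bounds(1)[OF _ bt]]) auto
  have dF: "(F has_real_derivative F' t) (at t)" for t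
    unfolding F_def F'_def by (rule DERIV_integral_exp[OF Z B])
  have dL: "((\<lambda>t. ln (F t)) has_real_derivative F' t / F t) (at t)" for t
    using F by (auto intro!: derivative_eq_intros dF)
  have F0: "F 0 = 1" "F' 0 = E" by (auto simp: F_def F'_def E_def prob_space)
  \<comment> \<open>Since ln F vanishes at 0, the quotient ln (F t) / t is a difference quotient
    there.\<close>
  have "((\<lambda>h. (ln (F (0 + h)) - ln (F 0)) / h) \<longlongrightarrow> F' 0 / F 0) (at 0)"
    using dL[of 0] unfolding DERIV_def .
  then have lim1: "((\<lambda>t. ln (F t) / t) \<longlongrightarrow> E) (at_right 0)"
    by (simp add: F0 filterlim_at_split)
  have "((\<lambda>t. ln (F t)) \<longlongrightarrow> ln (F 0)) (at 0)"
    using DERIV_isCont[OF dL[of 0]] by (simp add: isCont_def)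
  then have lim2: "((\<lambda>t. ln (F t)) \<longlongrightarrow> 0) (at_right 0)"
    by (simp add: F0 filterlim_at_split)
  have "((\<lambda>t. ln (F t) / t - a * ln (F t)) \<longlongrightarrow> E - a * 0) (at_right 0)"
    by (intro tendsto_intros lim1 lim2)
  then have lim: "(K \<longlongrightarrow> E) (at_right 0)" by (simp add: K_def[abs_def])
  have mono: "K l \<le> K s" if s: "0 < s" "s < l" for s
  proof (rule DERIV_nonpos_imp_nonincreasing[where f = K])
    show "s \<le> l" using s by simp
    fix t assume "s \<le> t" "t \<le> l"
    then have t: "0 < t" "t \<le> l" using s by auto
    have "(K has_real_derivative (F' t / F t * t - ln (F t) * 1) / (t * t) - a * (F' t / F t)) (at t)"
      unfolding K_def[abs_def] using t by (intro DERIV_diff DERIV_divide DERIV_cmult dL DERIV_ident) auto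
    moreover have "(F' t / F t * t - ln (F t) * 1) / (t * t) - a * (F' t / F t) \<le> 0"
    proof -
      have "(\<integral>x. exp (t * Z x) * (t * Z x) \<partial>M) = t * F' t"
        by (simp add: F'_def mult.left_commute[of _ t])
      then have "t * F' t - F t * ln (F t) \<le> a * t\<^sup>2 * F' t"
        using ent[OF t] by (simp add: ent_exp_def F_def F'_def)
      then have "(t * F' t - F t * ln (F t)) / (F t * t\<^sup>2) \<le> (a * t\<^sup>2 * F' t) / (F t * t\<^sup>2)"
        using F[of t] by (intro divide_right_mono) auto
      moreover have "(t * F' t - F t * ln (F t)) / (F t * t\<^sup>2)
          = (F' t / F t * t - ln (F t) * 1) / (t * t)"
        using F[of t] t(1) by (simp add: diff_divide_distrib power2_eq_square)
      moreover have "(a * t\<^sup>2 * F' t) / (F t * t\<^sup>2) = a * (F' t / F t)"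
        using t(1) by simp
      ultimately show ?thesis by simp
    qed
    ultimately show "\<exists>y. (K has_real_derivative y) (at t) \<and> y \<le> 0" by blast
  qed
  have "K l \<le> E"
  proof (rule tendsto_lowerbound[OF lim])
    show "\<forall>\<^sub>F s in at_right 0. K l \<le> K s"
      using mono l(1) unfolding eventually_at_right_field by auto
  qed simp
  then have "l * K l \<le> l * E"
    using l(1) by (intro mult_left_mono) auto
  moreover have "l * K l = ln (F l) * (1 - a * l)"
    using l(1) by (simp add: K_def right_diff_distrib)
  ultimately have "ln (F l) * (1 - a * l) \<le> l * E" by simp
  then have *: "ln (F l) \<le> l * E / (1 - a * l)"
    using l(2) by (simp add: pos_le_divide_eq)
  have "(\<integral>x. exp (l * (Z x - E)) \<partial>M) = (\<integral>x. exp (l * Z x) * exp (- l * E) \<partial>M)"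
    by (simp add: right_diff_distrib exp_diff exp_minus divide_inverse)
  also have "\<dots> = F l * exp (- l * E)" by (simp add: F_def)
  finally have "ln (\<integral>x. exp (l * (Z x - E)) \<partial>M) = ln (F l) - l * E"
    using F[of l] by (simp add: ln_mult)
  also have "\<dots> \<le> l * E / (1 - a * l) - l * E" using * by simp
  \<comment> \<open>Centring subtracts l E, which turns the factor 1 / (1 - a l) into a l / (1 - a
    l).\<close>
  also have "\<dots> = (l * E - l * E * (1 - a * l)) / (1 - a * l)"
    using l(2) by (subst diff_divide_distrib) simp
  also have "l * E - l * E * (1 - a * l) = a * l\<^sup>2 * E"
    by (simp add: algebra_simps power2_eq_square)
  finally show ?thesis by (simp add: E_def)
qed

text \<open>The squared positive part is homogeneous of degree 2, so one self-bounding inequality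
  for \<open>Z\<close> serves every t * Z and yields the entropy hypothesis of Herbst's
  argument.\<close>

theorem ln_integral_exp_PiM_le:
  fixes Z :: "('i \<Rightarrow> 'a) \<Rightarrow> real"
  assumes M: "\<And>i. prob_space (M i)" and "finite I"
    and Z: "Z \<in> borel_measurable (PiM I M)" and B: "\<And>w. w \<in> space (PiM I M) \<Longrightarrow> \<bar>Z w\<bar> \<le> B"
    and V: "\<And>w. w \<in> space (PiM I M) \<Longrightarrow>
      (\<Sum>i\<in>I. \<integral>y. (max 0 (Z w - Z (w(i := y))))\<^sup>2 \<partial>M i) \<le> a * Z w"
    and l: "0 < l" "a * l < 1"
  shows "ln (\<integral>w. exp (l * (Z w - (\<integral>w. Z w \<partial>PiM I M))) \<partial>PiM I M)
    \<le> a * l\<^sup>2 * (\<integral>w. Z w \<partial>PiM I M) / (1 - a * l)"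
proof -
  interpret PI: prob_space "PiM I M" by (intro prob_space_PiM M)
  show ?thesis
  proof (rule PI.ln_integral_exp_le_of_ent_exp_le[OF Z B l])
    fix t :: real assume t: "0 < t"
    have tZ: "(\<lambda>w. t * Z w) \<in> borel_measurable (PiM I M)" using Z by simp
    have tB: "\<bar>t * Z w\<bar> \<le> t * B" if "w \<in> space (PiM I M)" for w
      using B[OF that] t by (simp add: abs_mult)
    have "max 0 (t * u - t * v) = t * max 0 (u - v)" for u v
      using t by (simp add: max_def right_diff_distrib[symmetric] zero_le_mult_iff)
    then have Vt: "(\<Sum>i\<in>I. \<integral>y. (max 0 (t * Z w - t * Z (w(i := y))))\<^sup>2 \<partial>M i)
        = t\<^sup>2 * (\<Sum>i\<in>I. \<integral>y. (max 0 (Z w - Z (w(i := y))))\<^sup>2 \<partial>M i)" for w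
      by (simp add: power_mult_distrib sum_distrib_left)
    have "ent_exp (PiM I M) (\<lambda>w. t * Z w)
      \<le> (\<integral>w. exp (t * Z w) * (\<Sum>i\<in>I. \<integral>y. (max 0 (t * Z w - t * Z (w(i := y))))\<^sup>2 \<partial>M i) \<partial>PiM I M)"
      by (rule ent_exp_PiM_le[OF M \<open>finite I\<close> tZ tB])
    also have "\<dots> \<le> (\<integral>w. a * t\<^sup>2 * (exp (t * Z w) * Z w) \<partial>PiM I M)"
    \<comment> \<open>Integrability is asked only of the right side, which in exchange must be
      nonnegative; this follows because it dominates a sum of integrals of squares.\<close>
    proof (rule integral_mono')
      show "integrable (PiM I M) (\<lambda>w. a * t\<^sup>2 * (exp (t * Z w) * Z w))"
        using PI.integrable_exp_mult[OF tZ tB Z B] by simp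
      fix w assume w: "w \<in> space (PiM I M)"
      show le: "exp (t * Z w) * (\<Sum>i\<in>I. \<integral>y. (max 0 (t * Z w - t * Z (w(i := y))))\<^sup>2 \<partial>M i)
          \<le> a * t\<^sup>2 * (exp (t * Z w) * Z w)"
        unfolding Vt using mult_left_mono[OF V[OF w], of "exp (t * Z w) * t\<^sup>2"] by (simp add: mult_ac)
      have "0 \<le> exp (t * Z w) * (\<Sum>i\<in>I. \<integral>y. (max 0 (t * Z w - t * Z (w(i := y))))\<^sup>2 \<partial>M i)"
        by (intro mult_nonneg_nonneg sum_nonneg Bochner_Integration.integral_nonneg) auto
      with le show "0 \<le> a * t\<^sup>2 * (exp (t * Z w) * Z w)" by linarith
    qed
    finally show "ent_exp (PiM I M) (\<lambda>w. t * Z w) \<le> a * t\<^sup>2 * (\<integral>w. exp (t * Z w) * Z w \<partial>PiM I M)"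
      by simp
  qed
qed

section \<open>The offset process\<close>

text \<open>Clipping the noise changes U only on a null set and makes it bounded everywhere.\<close>

definition clip_snd :: "real \<Rightarrow> 'a \<times> real \<Rightarrow> 'a \<times> real" where
  "clip_snd \<sigma> p = (fst p, max (- \<sigma>) (min \<sigma> (snd p)))"

lemma abs_snd_clip_snd: "0 \<le> \<sigma> \<Longrightarrow> \<bar>snd (clip_snd \<sigma> p)\<bar> \<le> \<sigma>"
  by (auto simp: clip_snd_def)

lemma clip_snd_eq: "\<bar>snd p\<bar> \<le> \<sigma> \<Longrightarrow> clip_snd \<sigma> p = p"
  by (cases p) (auto simp: clip_snd_def)

lemma measurable_clip_snd: "clip_snd \<sigma> \<in> measurable (N \<Otimes>\<^sub>M borel) (N \<Otimes>\<^sub>M borel)"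
  unfolding clip_snd_def[abs_def] by measurable

lemma AE_Linf_norm_le:
  assumes "Linf_norm M f \<le> ereal B"
  shows "AE x in M. \<bar>f x\<bar> \<le> B"
proof -
  have "AE x in M. ereal \<bar>f x\<bar> \<le> esssup M (\<lambda>x. ereal \<bar>f x\<bar>)" by (rule esssup_AE)
  then show ?thesis
  proof eventually_elim
    case (elim x)
    then have "ereal \<bar>f x\<bar> \<le> ereal B" using assms unfolding Linf_norm_def by (rule order_trans)
    then show ?case by simp
  qed
qed

section \<open>The star hull, the objective and almost sure bounds\<close>

locale bounded_offset_class = prob_space P for P :: "('a \<times> real) measure" +
  fixes N :: "'a measure" and H :: "('a \<Rightarrow> real) set" and \<gamma> \<kappa> \<sigma> :: real
  assumes sets_P: "sets P = sets (N \<Otimes>\<^sub>M borel)"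
    and H_nonempty: "H \<noteq> {}" and H_measurable: "H \<subseteq> borel_measurable N"
    and gamma: "\<gamma> > 0" and kappa: "\<kappa> > 0" and sigma: "\<sigma> > 0"
    and Linf_H: "(SUP h\<in>H. Linf_norm (marg_X N P) h) \<le> ereal \<kappa>"
    and Linf_zeta: "Linf_norm (marg_zeta P) (\<lambda>z. z) \<le> ereal \<sigma>"
begin

lemma measurable_P: "measurable P L = measurable (N \<Otimes>\<^sub>M borel) L"
  by (rule measurable_cong_sets[OF sets_P refl])

definition summand :: "('a \<Rightarrow> real) \<Rightarrow> 'a \<times> real \<Rightarrow> real" where
  "summand h p = snd p * h (fst p) - \<gamma> * (h (fst p))\<^sup>2"

definition cross :: "('a \<Rightarrow> real) \<Rightarrow> real" where
  "cross h = (\<integral>p. snd p * h (fst p) \<partial>P)"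

definition second :: "('a \<Rightarrow> real) \<Rightarrow> real" where
  "second h = (\<integral>p. (h (fst p))\<^sup>2 \<partial>P)"

text \<open>The quantity under the supremum in \<open>U_stat\<close>, with the expectations
  collected in one term that does not involve the sample. A change of one sample point then changes
  one summand only.\<close>

definition objective :: "nat \<Rightarrow> ('a \<Rightarrow> real) \<Rightarrow> (nat \<Rightarrow> 'a \<times> real) \<Rightarrow> real" where
  "objective n h s = (\<Sum>i<n. summand h (s i)) - real n * (cross h + \<gamma> * second h)"

lemma star_measurable: "h \<in> star H \<Longrightarrow> h \<in> borel_measurable N"
  using H_measurable by (auto simp: star_def)

lemma star_scale:
  assumes "h \<in> star H" "0 \<le> c" "c \<le> 1"
  shows "(\<lambda>x. c * h x) \<in> star H"
proof -
  obtain d g where "h = (\<lambda>x. d * g x)" "g \<in> H" "0 \<le> d" "d \<le> 1" using assms(1) by (auto simp: star_def)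
  then show ?thesis using assms(2,3) unfolding star_def
    by (auto intro!: exI[of _ "c * d"] exI[of _ g] mult_le_one)
qed

lemma zero_in_star: "(\<lambda>x. 0) \<in> star H"
proof -
  obtain h where "h \<in> H" using H_nonempty by auto
  then show ?thesis unfolding star_def by (auto intro!: exI[of _ 0] exI[of _ h])
qed

lemma AE_snd_le: "AE p in P. \<bar>snd p\<bar> \<le> \<sigma>"
  using AE_Linf_norm_le[OF Linf_zeta] unfolding marg_zeta_def
  by (rule AE_distrD[rotated]) (simp add: measurable_P)

text \<open>The exceptional null set depends on \<open>h\<close>, so this applies to a function
  chosen before \<open>p\<close> is drawn.\<close>

lemma AE_star_le:
  assumes "h \<in> star H"
  shows "AE p in P. \<bar>h (fst p)\<bar> \<le> \<kappa>"
proof -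
  obtain d g where dg: "h = (\<lambda>x. d * g x)" "g \<in> H" "0 \<le> d" "d \<le> 1" using assms by (auto simp: star_def)
  have "Linf_norm (marg_X N P) g \<le> ereal \<kappa>"
    by (rule order_trans[OF SUP_upper[OF dg(2)] Linf_H])
  then have "AE x in marg_X N P. \<bar>g x\<bar> \<le> \<kappa>" by (rule AE_Linf_norm_le)
  then have "AE p in P. \<bar>g (fst p)\<bar> \<le> \<kappa>" unfolding marg_X_def
    by (rule AE_distrD[rotated]) (simp add: measurable_P)
  then show ?thesis
  proof eventually_elim
    case (elim p)
    have "d * \<bar>g (fst p)\<bar> \<le> 1 * \<kappa>" using elim dg(3,4) by (intro mult_mono) auto
    then show ?case using dg(3) by (simp add: dg(1) abs_mult)
  qed
qed

lemma measurable_eval: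
  assumes "h \<in> star H"
  shows "(\<lambda>p. h (fst p)) \<in> borel_measurable P"
  using star_measurable[OF assms] unfolding measurable_P by measurable

lemma measurable_snd_P: "snd \<in> borel_measurable P"
  unfolding measurable_P by measurable

lemma abs_cross_le:
  assumes "h \<in> star H"
  shows "\<bar>cross h\<bar> \<le> \<sigma> * \<kappa>"
  unfolding cross_def
proof (rule abs_integral_le)
  show "(\<lambda>p. snd p * h (fst p)) \<in> borel_measurable P"
    using measurable_eval[OF assms] measurable_snd_P by simp
  show "AE p in P. \<bar>snd p * h (fst p)\<bar> \<le> \<sigma> * \<kappa>"
    using AE_snd_le AE_star_le[OF assms]
    by eventually_elim (use sigma in \<open>auto simp: abs_mult intro!: mult_mono\<close>)
qed

lemma second_nonneg: "0 \<le> second h"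
  unfolding second_def by (rule integral_nonneg_AE) auto

lemma integrable_square:
  assumes "h \<in> star H"
  shows "integrable P (\<lambda>p. (h (fst p))\<^sup>2)"
proof (rule integrable_const_bound[where B = "\<kappa>\<^sup>2"])
  show "AE p in P. norm ((h (fst p))\<^sup>2) \<le> \<kappa>\<^sup>2"
    using AE_star_le[OF assms]
    by eventually_elim (use kappa in \<open>simp add: abs_le_square_iff[symmetric]\<close>)
qed (use measurable_eval[OF assms] in simp)

lemma U_stat_eq: "U_stat N P H \<gamma> n s = (SUP h\<in>star H. objective n h s)"
  unfolding U_stat_def
proof (rule SUP_cong)
  fix h assume h: "h \<in> star H"
  have "(\<integral>x. (h x)\<^sup>2 \<partial>marg_X N P) = second h"
    unfolding marg_X_def second_def using star_measurable[OF h]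
    by (subst integral_distr) (auto simp: measurable_P)
  moreover have "(\<integral>(x, z). z * h x \<partial>P) = cross h"
    unfolding cross_def by (simp add: split_beta')
  ultimately show "(\<Sum>i<n. snd (s i) * h (fst (s i)) - (\<integral>(x, z). z * h x \<partial>P)
        - \<gamma> * (h (fst (s i)))\<^sup>2 - \<gamma> * (\<integral>x. (h x)\<^sup>2 \<partial>marg_X N P)) = objective n h s"
    by (simp add: objective_def summand_def sum_subtractf sum.distrib algebra_simps)
qed simp

section \<open>Bounds for the summands and the supremum\<close>

lemma U_stat_cong: "(\<And>i. i < n \<Longrightarrow> s i = s' i) \<Longrightarrow> U_stat N P H \<gamma> n s = U_stat N P H \<gamma> n s'"
  unfolding U_stat_def by (intro SUP_cong sum.cong) auto

text \<open>Both bounds hold whatever the size of \<open>h (fst p)\<close>: the first maximises the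
  quadratic in h by completing the square, the second drops the negative square.\<close>

lemma summand_le:
  assumes "\<bar>snd p\<bar> \<le> \<sigma>"
  shows "summand h p \<le> \<sigma>\<^sup>2 / (4 * \<gamma>)" "summand h p \<le> \<sigma> * \<bar>h (fst p)\<bar>"
proof -
  let ?y = "h (fst p)"
  have "snd p * ?y \<le> \<bar>snd p\<bar> * \<bar>?y\<bar>" using abs_ge_self[of "snd p * ?y"] by (simp add: abs_mult)
  also have "\<dots> \<le> \<sigma> * \<bar>?y\<bar>" using assms by (intro mult_right_mono) auto
  finally have *: "snd p * ?y \<le> \<sigma> * \<bar>?y\<bar>" .
  moreover have "0 \<le> \<gamma> * ?y\<^sup>2" using gamma by simp
  ultimately show "summand h p \<le> \<sigma> * \<bar>?y\<bar>" unfolding summand_def by linarith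
  have "0 \<le> (\<sigma> - 2 * \<gamma> * \<bar>?y\<bar>)\<^sup>2 / (4 * \<gamma>)" using gamma by simp
  also have "\<dots> = \<sigma>\<^sup>2 / (4 * \<gamma>) - \<sigma> * \<bar>?y\<bar> + \<gamma> * ?y\<^sup>2"
    using gamma by (simp add: field_simps power2_eq_square)
  finally show "summand h p \<le> \<sigma>\<^sup>2 / (4 * \<gamma>)" using * unfolding summand_def by linarith
qed

text \<open>This secures that the supremum is finite and \<open>U_stat\<close> bounded, as the
  entropy method requires. Its size does not enter the final inequality.\<close>

lemma objective_le:
  assumes "h \<in> star H" "\<And>i. i < n \<Longrightarrow> \<bar>snd (s i)\<bar> \<le> \<sigma>"
  shows "objective n h s \<le> real n * (\<sigma>\<^sup>2 / (4 * \<gamma>) + \<sigma> * \<kappa>)"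
proof -
  have "(\<Sum>i<n. summand h (s i)) \<le> (\<Sum>i<n. \<sigma>\<^sup>2 / (4 * \<gamma>))"
    using assms(2) by (intro sum_mono summand_le) auto
  moreover have "real n * - (\<sigma> * \<kappa>) \<le> real n * (cross h + \<gamma> * second h)"
  proof (rule mult_left_mono)
    have "0 \<le> \<gamma> * second h" using gamma second_nonneg by simp
    then show "- (\<sigma> * \<kappa>) \<le> cross h + \<gamma> * second h" using abs_cross_le[OF assms(1)] by linarith
  qed simp
  ultimately show ?thesis by (simp add: objective_def algebra_simps)
qed

lemma objective_le_U_stat:
  assumes "h \<in> star H" "\<And>i. i < n \<Longrightarrow> \<bar>snd (s i)\<bar> \<le> \<sigma>"
  shows "objective n h s \<le> U_stat N P H \<gamma> n s"
  unfolding U_stat_eq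
  using assms(1) objective_le[OF _ assms(2)] by (intro cSUP_upper bdd_aboveI2) auto

lemma U_stat_bounds:
  assumes "\<And>i. i < n \<Longrightarrow> \<bar>snd (s i)\<bar> \<le> \<sigma>"
  shows "0 \<le> U_stat N P H \<gamma> n s" "U_stat N P H \<gamma> n s \<le> real n * (\<sigma>\<^sup>2 / (4 * \<gamma>) + \<sigma> * \<kappa>)"
proof -
  have "objective n (\<lambda>x. 0) s = 0"
    by (simp add: objective_def summand_def cross_def second_def)
  then show "0 \<le> U_stat N P H \<gamma> n s" using objective_le_U_stat[OF zero_in_star, of n s] assms by simp
  show "U_stat N P H \<gamma> n s \<le> real n * (\<sigma>\<^sup>2 / (4 * \<gamma>) + \<sigma> * \<kappa>)"
    unfolding U_stat_eq using zero_in_star objective_le[OF _ assms] by (intro cSUP_least) auto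
qed

section \<open>Self-bounding property of the supremum\<close>

lemma near_maximiser_energy_le:
  assumes h: "h \<in> star H" and s: "\<And>i. i < n \<Longrightarrow> \<bar>snd (s i)\<bar> \<le> \<sigma>"
    and \<delta>: "0 < \<delta>" "\<delta> < 1" and max: "U_stat N P H \<gamma> n s - \<delta>\<^sup>2 \<le> objective n h s"
  shows "\<gamma> * ((\<Sum>i<n. (h (fst (s i)))\<^sup>2) + real n * second h) \<le> U_stat N P H \<gamma> n s / (1 - \<delta>) + \<delta>"
proof -
  \<comment> \<open>The competitor is c h, at which the objective is c L - c^2 Q. Comparing with
    near-optimality of h gives c (1 - c) Q <= (1 - c) Z + c \<delta>^2. A slack of \<delta>^2
    against a shrinkage 1 - c = \<delta> leaves an error of order \<delta> after division by
    \<delta>.\<close>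
  define c where "c = 1 - \<delta>"
  have c: "0 < c" "c < 1" using \<delta> by (auto simp: c_def)
  define Z where "Z = U_stat N P H \<gamma> n s"
  define L where "L = (\<Sum>i<n. snd (s i) * h (fst (s i))) - real n * cross h"
  define Q where "Q = \<gamma> * ((\<Sum>i<n. (h (fst (s i)))\<^sup>2) + real n * second h)"
  have 1: "objective n h s = L - Q"
    by (simp add: objective_def summand_def L_def Q_def sum_subtractf sum_distrib_left algebra_simps)
  have "cross (\<lambda>x. c * h x) = c * cross h" "second (\<lambda>x. c * h x) = c\<^sup>2 * second h"
    by (simp_all add: cross_def second_def mult.left_commute[of _ c] power_mult_distrib)
  then have "objective n (\<lambda>x. c * h x) s = c * L - c\<^sup>2 * Q"
    by (simp add: objective_def summand_def L_def Q_def sum_subtractf sum_distrib_left power_mult_distrib algebra_simps)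
  then have "c * L - c\<^sup>2 * Q \<le> Z"
    using objective_le_U_stat[OF star_scale[OF h, of c], of n s] s c unfolding Z_def by simp
  moreover have "c * (Z - \<delta>\<^sup>2 + Q) \<le> c * L"
    using max 1 c by (intro mult_left_mono) (auto simp: Z_def)
  ultimately have "c * (1 - c) * Q \<le> (1 - c) * Z + c * \<delta>\<^sup>2"
    by (simp add: algebra_simps power2_eq_square)
  then have "\<delta> * (c * Q) \<le> \<delta> * (Z + c * \<delta>)"
    by (simp add: c_def algebra_simps power2_eq_square)
  then have "c * Q \<le> Z + c * \<delta>" using \<delta>(1) by simp
  then have "Q \<le> (Z + c * \<delta>) / c" using c(1) by (simp add: pos_le_divide_eq mult.commute)
  also have "\<dots> = Z / c + \<delta>" using c(1) by (simp add: add_divide_distrib)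
  finally show ?thesis by (simp add: Q_def Z_def c_def)
qed

text \<open>The function nearly optimal at \<open>s\<close> is still a competitor after resampling,
  and there the two objectives differ only in summand i.\<close>

lemma U_stat_diff_le:
  assumes h: "h \<in> star H" and s: "\<And>i. i < n \<Longrightarrow> \<bar>snd (s i)\<bar> \<le> \<sigma>"
    and max: "U_stat N P H \<gamma> n s - \<epsilon> \<le> objective n h s" and i: "i < n" and p: "\<bar>snd p\<bar> \<le> \<sigma>"
  shows "U_stat N P H \<gamma> n s - U_stat N P H \<gamma> n (s(i := p)) \<le> summand h (s i) - summand h p + \<epsilon>"
proof -
  have "objective n h (s(i := p)) \<le> U_stat N P H \<gamma> n (s(i := p))"
    using s p by (intro objective_le_U_stat[OF h]) auto
  moreover have "(\<Sum>j<n. summand h (s j)) = summand h (s i) + (\<Sum>j\<in>{..<n} - {i}. summand h (s j))"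
    using i by (intro sum.remove) auto
  moreover have "(\<Sum>j<n. summand h ((s(i := p)) j)) = summand h p + (\<Sum>j\<in>{..<n} - {i}. summand h (s j))"
    using i by (subst sum.remove[of _ i]) auto
  ultimately show ?thesis using max unfolding objective_def by linarith
qed

text \<open>With the sign reversed the square works against the bound, and it is made linear in |h|
  by means of |h| <= \<kappa>.\<close>

lemma neg_summand_le:
  assumes "\<bar>snd p\<bar> \<le> \<sigma>" "\<bar>h (fst p)\<bar> \<le> \<kappa>"
  shows "- summand h p \<le> (\<sigma> + \<gamma> * \<kappa>) * \<bar>h (fst p)\<bar>"
proof -
  let ?y = "h (fst p)"
  have "- (snd p * ?y) \<le> \<bar>snd p\<bar> * \<bar>?y\<bar>" using abs_ge_minus_self[of "snd p * ?y"] by (simp add: abs_mult)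
  also have "\<dots> \<le> \<sigma> * \<bar>?y\<bar>" using assms by (intro mult_right_mono) auto
  finally have 1: "- (snd p * ?y) \<le> \<sigma> * \<bar>?y\<bar>" .
  have "\<gamma> * (\<bar>?y\<bar> * \<bar>?y\<bar>) \<le> \<gamma> * (\<kappa> * \<bar>?y\<bar>)"
    using assms gamma by (intro mult_left_mono mult_right_mono) auto
  then have 2: "\<gamma> * ?y\<^sup>2 \<le> \<gamma> * \<kappa> * \<bar>?y\<bar>" by (simp add: power2_eq_square mult.assoc)
  show ?thesis using 1 2 by (simp add: summand_def distrib_right)
qed

text \<open>The decrease is at most a + b + \<epsilon>, with a the positive part of the old summand
  and b that of the negated new one. Then (a + b)^2 <= 2 a^2 + 2 b^2 and (\<sigma> + \<gamma>
  \<kappa>)^2 <= 2 (\<sigma>^2 + \<gamma>^2 \<kappa>^2) give the factor 4.\<close>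

lemma square_decrease_le:
  assumes p: "\<bar>snd p\<bar> \<le> \<sigma>" and q: "\<bar>snd q\<bar> \<le> \<sigma>" "\<bar>h (fst q)\<bar> \<le> \<kappa>" and \<epsilon>: "0 \<le> \<epsilon>"
    and d: "d \<le> summand h p - summand h q + \<epsilon>"
  shows "(max 0 d)\<^sup>2 \<le> 4 * (\<sigma>\<^sup>2 + \<gamma>\<^sup>2 * \<kappa>\<^sup>2) * ((h (fst p))\<^sup>2 + (h (fst q))\<^sup>2)
    + \<epsilon> * (2 * (\<sigma>\<^sup>2 / (4 * \<gamma>) + (\<sigma> + \<gamma> * \<kappa>) * \<kappa>) + \<epsilon>)"
proof -
  define a where "a = max 0 (summand h p)"
  define b where "b = max 0 (- summand h q)"
  \<comment> \<open>A bound for a + b free of h, so that the terms with \<epsilon> vanish uniformly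
    in h.\<close>
  define B where "B = \<sigma>\<^sup>2 / (4 * \<gamma>) + (\<sigma> + \<gamma> * \<kappa>) * \<kappa>"
  have a: "0 \<le> a" "a \<le> \<sigma>\<^sup>2 / (4 * \<gamma>)" "a \<le> \<sigma> * \<bar>h (fst p)\<bar>"
    using summand_le[OF p, of h] gamma sigma by (auto simp: a_def)
  have b: "0 \<le> b" "b \<le> (\<sigma> + \<gamma> * \<kappa>) * \<bar>h (fst q)\<bar>"
    using neg_summand_le[of q h] q gamma sigma kappa by (auto simp: b_def)
  have "(\<sigma> + \<gamma> * \<kappa>) * \<bar>h (fst q)\<bar> \<le> (\<sigma> + \<gamma> * \<kappa>) * \<kappa>"
    using q gamma sigma kappa by (intro mult_left_mono) auto
  then have ab: "a + b \<le> B" using a b unfolding B_def by linarith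
  have "a\<^sup>2 \<le> (\<sigma> * \<bar>h (fst p)\<bar>)\<^sup>2" using a by (intro power_mono)
  then have a2: "a\<^sup>2 \<le> \<sigma>\<^sup>2 * (h (fst p))\<^sup>2" by (simp add: power_mult_distrib)
  have "b\<^sup>2 \<le> ((\<sigma> + \<gamma> * \<kappa>) * \<bar>h (fst q)\<bar>)\<^sup>2" using b by (intro power_mono)
  then have "b\<^sup>2 \<le> (\<sigma> + \<gamma> * \<kappa>)\<^sup>2 * (h (fst q))\<^sup>2" by (simp add: power_mult_distrib)
  also have "\<dots> \<le> (2 * (\<sigma>\<^sup>2 + \<gamma>\<^sup>2 * \<kappa>\<^sup>2)) * (h (fst q))\<^sup>2"
  proof (rule mult_right_mono)
    have "0 \<le> (\<sigma> - \<gamma> * \<kappa>)\<^sup>2" by simp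
    then show "(\<sigma> + \<gamma> * \<kappa>)\<^sup>2 \<le> 2 * (\<sigma>\<^sup>2 + \<gamma>\<^sup>2 * \<kappa>\<^sup>2)" by (simp add: power2_eq_square algebra_simps)
  qed simp
  finally have b2: "b\<^sup>2 \<le> (2 * (\<sigma>\<^sup>2 + \<gamma>\<^sup>2 * \<kappa>\<^sup>2)) * (h (fst q))\<^sup>2" .
  have "(max 0 d)\<^sup>2 \<le> (a + b + \<epsilon>)\<^sup>2"
    using d \<epsilon> a(1) b(1) unfolding a_def b_def by (intro power_mono) auto
  also have "\<dots> = (a + b)\<^sup>2 + \<epsilon> * (2 * (a + b) + \<epsilon>)" by (simp add: power2_eq_square algebra_simps)
  also have "\<dots> \<le> (2 * a\<^sup>2 + 2 * b\<^sup>2) + \<epsilon> * (2 * B + \<epsilon>)"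
  proof (rule add_mono)
    have "0 \<le> (a - b)\<^sup>2" by simp
    then show "(a + b)\<^sup>2 \<le> 2 * a\<^sup>2 + 2 * b\<^sup>2" by (simp add: power2_eq_square algebra_simps)
    show "\<epsilon> * (2 * (a + b) + \<epsilon>) \<le> \<epsilon> * (2 * B + \<epsilon>)" using ab \<epsilon> by (intro mult_left_mono) auto
  qed
  also have "2 * a\<^sup>2 + 2 * b\<^sup>2 \<le> 4 * (\<sigma>\<^sup>2 + \<gamma>\<^sup>2 * \<kappa>\<^sup>2) * ((h (fst p))\<^sup>2 + (h (fst q))\<^sup>2)"
  proof -
    have "2 * a\<^sup>2 \<le> 4 * (\<sigma>\<^sup>2 + \<gamma>\<^sup>2 * \<kappa>\<^sup>2) * (h (fst p))\<^sup>2"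
    proof -
      \<comment> \<open>The old point alone would allow 2 \<sigma>^2; the constant is enlarged to
        the one for b so that both squares of h share a common factor.\<close>
      have "2 * a\<^sup>2 \<le> (2 * \<sigma>\<^sup>2) * (h (fst p))\<^sup>2" using a2 by simp
      also have "\<dots> \<le> 4 * (\<sigma>\<^sup>2 + \<gamma>\<^sup>2 * \<kappa>\<^sup>2) * (h (fst p))\<^sup>2" by (intro mult_right_mono) auto
      finally show ?thesis .
    qed
    moreover have "2 * b\<^sup>2 \<le> 4 * (\<sigma>\<^sup>2 + \<gamma>\<^sup>2 * \<kappa>\<^sup>2) * (h (fst q))\<^sup>2"
      using b2 by (simp only: mult.assoc)
    ultimately show ?thesis by (simp add: distrib_left)
  qed
  finally show ?thesis by (simp add: B_def)
qed

lemma sum_square_decrease_le: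
  assumes s: "\<And>i. i < n \<Longrightarrow> \<bar>snd (s i)\<bar> \<le> \<sigma>"
  shows "(\<Sum>i<n. \<integral>p. (max 0 (U_stat N P H \<gamma> n s - U_stat N P H \<gamma> n (s(i := clip_snd \<sigma> p))))\<^sup>2 \<partial>P)
    \<le> 4 * (\<sigma>\<^sup>2 / \<gamma> + \<gamma> * \<kappa>\<^sup>2) * U_stat N P H \<gamma> n s"
proof -
  define Z where "Z = U_stat N P H \<gamma> n"
  define D where "D = 4 * (\<sigma>\<^sup>2 + \<gamma>\<^sup>2 * \<kappa>\<^sup>2)"
  define B where "B = 2 * (\<sigma>\<^sup>2 / (4 * \<gamma>) + (\<sigma> + \<gamma> * \<kappa>) * \<kappa>)"
  define V where "V = (\<Sum>i<n. \<integral>p. (max 0 (Z s - Z (s(i := clip_snd \<sigma> p))))\<^sup>2 \<partial>P)"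
  \<comment> \<open>The bound obtained from a \<delta>^2-maximiser. That function varies with
    \<delta> but does not occur in \<open>b\<close>, so \<delta> can tend to 0.\<close>
  define b where "b \<delta> = 4 * (\<sigma>\<^sup>2 / \<gamma> + \<gamma> * \<kappa>\<^sup>2) * (Z s / (1 - \<delta>) + \<delta>) + real n * (\<delta>\<^sup>2 * (B + \<delta>\<^sup>2))" for \<delta> :: real
  \<comment> \<open>Splitting off \<gamma> exposes the quantity controlled by
    \<open>near_maximiser_energy_le\<close>; the other factor will be \<eta> / 2.\<close>
  have D: "D = 4 * (\<sigma>\<^sup>2 / \<gamma> + \<gamma> * \<kappa>\<^sup>2) * \<gamma>"
    using gamma by (simp add: D_def field_simps power2_eq_square)
  have D0: "0 \<le> D" by (simp add: D_def)
  have B0: "0 \<le> B" using gamma sigma kappa by (simp add: B_def)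
  have bound: "V \<le> b \<delta>" if \<delta>: "0 < \<delta>" "\<delta> < 1" for \<delta>
  proof -
    have "Z s - \<delta>\<^sup>2 < (SUP h\<in>star H. objective n h s)" using \<delta> by (simp add: Z_def U_stat_eq)
    moreover have "star H \<noteq> {}" "bdd_above ((\<lambda>h. objective n h s) ` star H)"
      using zero_in_star bdd_aboveI2[OF objective_le[of _ n s, OF _ s]] by auto
    ultimately obtain h where h: "h \<in> star H" "Z s - \<delta>\<^sup>2 < objective n h s"
      by (auto simp: less_cSUP_iff)
    have "(\<integral>p. (max 0 (Z s - Z (s(i := clip_snd \<sigma> p))))\<^sup>2 \<partial>P)
        \<le> D * ((h (fst (s i)))\<^sup>2 + second h) + \<delta>\<^sup>2 * (B + \<delta>\<^sup>2)" if i: "i < n" for i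
    proof -
      let ?r = "\<lambda>p. D * ((h (fst (s i)))\<^sup>2 + (h (fst p))\<^sup>2) + \<delta>\<^sup>2 * (B + \<delta>\<^sup>2)"
      have "(\<integral>p. (max 0 (Z s - Z (s(i := clip_snd \<sigma> p))))\<^sup>2 \<partial>P) \<le> (\<integral>p. ?r p \<partial>P)"
      \<comment> \<open>Here \<open>h\<close> was selected from \<open>s\<close> alone, so its
        exceptional set is a fixed null set for the law of the new point p.\<close>
      proof (rule integral_mono_AE')
        show "integrable P ?r" using integrable_square[OF h(1)] by simp
        show "AE p in P. (max 0 (Z s - Z (s(i := clip_snd \<sigma> p))))\<^sup>2 \<le> ?r p"
          using AE_snd_le AE_star_le[OF h(1)]
        proof eventually_elim
          case (elim p)
          have "Z s - Z (s(i := p)) \<le> summand h (s i) - summand h p + \<delta>\<^sup>2"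
            unfolding Z_def using h(2) by (intro U_stat_diff_le[OF h(1) s _ i elim(1)]) (auto simp: Z_def)
          from square_decrease_le[of "s i" p h, OF s[OF i] elim _ this]
          show ?case by (simp add: clip_snd_eq[OF elim(1)] D_def B_def)
        qed
        show "AE p in P. 0 \<le> ?r p" using D0 B0 by simp
      qed
      also have "\<dots> = D * ((h (fst (s i)))\<^sup>2 + second h) + \<delta>\<^sup>2 * (B + \<delta>\<^sup>2)"
        using integrable_square[OF h(1)] by (simp add: second_def prob_space)
      finally show ?thesis .
    qed
    then have "V \<le> (\<Sum>i<n. D * ((h (fst (s i)))\<^sup>2 + second h) + \<delta>\<^sup>2 * (B + \<delta>\<^sup>2))"
      unfolding V_def by (intro sum_mono) auto
    also have "\<dots> = D * ((\<Sum>i<n. (h (fst (s i)))\<^sup>2) + real n * second h) + real n * (\<delta>\<^sup>2 * (B + \<delta>\<^sup>2))"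
      by (simp add: sum.distrib sum_distrib_left distrib_left)
    also have "D * ((\<Sum>i<n. (h (fst (s i)))\<^sup>2) + real n * second h)
        = 4 * (\<sigma>\<^sup>2 / \<gamma> + \<gamma> * \<kappa>\<^sup>2) * (\<gamma> * ((\<Sum>i<n. (h (fst (s i)))\<^sup>2) + real n * second h))"
      by (simp only: D mult.assoc)
    also have "\<dots> \<le> 4 * (\<sigma>\<^sup>2 / \<gamma> + \<gamma> * \<kappa>\<^sup>2) * (Z s / (1 - \<delta>) + \<delta>)"
      using near_maximiser_energy_le[of h n s, OF h(1) s \<delta>] h(2) gamma
      by (intro mult_left_mono) (auto simp: Z_def)
    finally show ?thesis by (simp add: b_def)
  qed
  have "(b \<longlongrightarrow> b 0) (at_right 0)"
    unfolding b_def by (intro tendsto_intros) auto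
  then have "V \<le> b 0"
  proof (rule tendsto_lowerbound)
    show "\<forall>\<^sub>F \<delta> in at_right 0. V \<le> b \<delta>"
      using bound unfolding eventually_at_right_field by (auto intro!: exI[of _ 1])
  qed simp
  then show ?thesis by (simp add: b_def V_def Z_def)
qed

end

section \<open>Transfer from the product law to the given sample\<close>

theorem proposition3p1:
  fixes N :: "'a measure" and P :: "('a \<times> real) measure" and M :: "'w measure"
    and H :: "('a \<Rightarrow> real) set"
    and X :: "nat \<Rightarrow> 'w \<Rightarrow> 'a" and \<zeta> :: "nat \<Rightarrow> 'w \<Rightarrow> real"
    and n :: nat and \<gamma> \<kappa> \<sigma> \<eta> lam :: real and U :: "'w \<Rightarrow> real"
  assumes P: "prob_space P" "sets P = sets (N \<Otimes>\<^sub>M borel)"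
    and H: "H \<noteq> {}" "H \<subseteq> borel_measurable N"
    and M: "prob_space M"
    and indep: "prob_space.indep_vars M (\<lambda>_. N \<Otimes>\<^sub>M borel) (\<lambda>i \<omega>. (X i \<omega>, \<zeta> i \<omega>)) {..<n}"
    and ident: "\<And>i. i < n \<Longrightarrow> distr M (N \<Otimes>\<^sub>M borel) (\<lambda>\<omega>. (X i \<omega>, \<zeta> i \<omega>)) = P"
    and gamma: "\<gamma> > 0"
    and U_measurable: "U_stat N P H \<gamma> n \<in> borel_measurable (\<Pi>\<^sub>M i\<in>{..<n}. N \<Otimes>\<^sub>M borel)"
    and U_eq: "U = (\<lambda>\<omega>. U_stat N P H \<gamma> n (\<lambda>i. (X i \<omega>, \<zeta> i \<omega>)))"
    and kappa: "\<kappa> > 0" "(SUP h\<in>H. Linf_norm (marg_X N P) h) \<le> ereal \<kappa>"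
    and sigma: "\<sigma> > 0" "Linf_norm (marg_zeta P) (\<lambda>z. z) \<le> ereal \<sigma>"
    and eta: "\<eta> = 8 * (\<sigma>\<^sup>2 / \<gamma> + \<gamma> * \<kappa>\<^sup>2)"
    and lam: "lam \<in> {0<..<1 / \<eta>}"
  shows "ln (\<integral>\<omega>. exp (lam * (U \<omega> - (\<integral>\<omega>'. U \<omega>' \<partial>M))) \<partial>M)
           \<le> lam\<^sup>2 * \<eta> * (\<integral>\<omega>. U \<omega> \<partial>M) / (2 * (1 - \<eta> * lam))"
proof -
  interpret bounded_offset_class P N H \<gamma> \<kappa> \<sigma>
    unfolding bounded_offset_class_def bounded_offset_class_axioms_def
    using P H gamma kappa sigma by simp
  interpret M: prob_space M by (rule M)
  define S where "S = N \<Otimes>\<^sub>M (borel :: real measure)"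
  define Y where "Y i \<omega> = (X i \<omega>, \<zeta> i \<omega>)" for i \<omega>
  define Q where "Q = PiM {..<n} (\<lambda>_. P)"
  \<comment> \<open>The sample as a point of the product space, hence undefined outside the first n
    indices; \<open>U_stat_cong\<close> makes the values there irrelevant.\<close>
  define T where "T \<omega> = (\<lambda>i\<in>{..<n}. Y i \<omega>)" for \<omega>
  \<comment> \<open>Clipping inside the statistic gives bounds at every point of the product space,
    as the entropy theorem demands.\<close>
  define Z where "Z w = U_stat N P H \<gamma> n (\<lambda>i. clip_snd \<sigma> (w i))" for w
  have Y: "Y i \<in> measurable M S" if "i < n" for i
    using indep that unfolding M.indep_vars_def2 Y_def[abs_def] S_def by auto
  have T_meas: "T \<in> measurable M (PiM {..<n} (\<lambda>_. S))"
    unfolding T_def[abs_def] using Y by (intro measurable_restrict) auto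
  have sets_Q: "sets Q = sets (PiM {..<n} (\<lambda>_. S))"
    unfolding Q_def S_def by (intro sets_PiM_cong refl sets_P)
  have Z_meas_S: "Z \<in> borel_measurable (PiM {..<n} (\<lambda>_. S))"
  proof -
    have "(\<lambda>w. \<lambda>i\<in>{..<n}. clip_snd \<sigma> (w i)) \<in> measurable (PiM {..<n} (\<lambda>_. S)) (PiM {..<n} (\<lambda>_. S))"
      unfolding S_def
      by (intro measurable_restrict measurable_compose[OF measurable_component_singleton[of _ "{..<n}" "\<lambda>_. N \<Otimes>\<^sub>M borel"] measurable_clip_snd])
    from measurable_compose[OF this U_measurable[folded S_def]]
    have "(\<lambda>w. U_stat N P H \<gamma> n (\<lambda>i\<in>{..<n}. clip_snd \<sigma> (w i))) \<in> borel_measurable (PiM {..<n} (\<lambda>_. S))" .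
    also have "(\<lambda>w. U_stat N P H \<gamma> n (\<lambda>i\<in>{..<n}. clip_snd \<sigma> (w i))) = Z"
      unfolding Z_def by (intro ext U_stat_cong) simp
    finally show ?thesis .
  qed
  have Z_meas: "Z \<in> borel_measurable Q"
    using Z_meas_S unfolding measurable_cong_sets[OF sets_Q refl] .
  have clip: "\<bar>snd (clip_snd \<sigma> p)\<bar> \<le> \<sigma>" for p :: "'a \<times> real"
    using sigma by (intro abs_snd_clip_snd) simp
  have Z_bounds: "0 \<le> Z w" "Z w \<le> real n * (\<sigma>\<^sup>2 / (4 * \<gamma>) + \<sigma> * \<kappa>)" for w
    unfolding Z_def using clip by (intro U_stat_bounds; simp)+
  have eta0: "\<eta> > 0" using sigma(1) kappa(1) gamma unfolding eta by (intro mult_pos_pos add_pos_pos) auto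
  have lam0: "0 < lam" "\<eta> * lam < 1" using lam eta0 by (auto simp: pos_less_divide_eq mult.commute)
  have V: "(\<Sum>i<n. \<integral>p. (max 0 (Z w - Z (w(i := p))))\<^sup>2 \<partial>P) \<le> \<eta> / 2 * Z w" for w
  proof -
    have Z_upd: "Z (w(i := p)) = U_stat N P H \<gamma> n ((\<lambda>i. clip_snd \<sigma> (w i))(i := clip_snd \<sigma> p))" for i p
      unfolding Z_def by (rule arg_cong[where f = "U_stat N P H \<gamma> n"]) auto
    have "\<eta> / 2 = 4 * (\<sigma>\<^sup>2 / \<gamma> + \<gamma> * \<kappa>\<^sup>2)" by (simp add: eta)
    then show ?thesis
      using sum_square_decrease_le[of n "\<lambda>i. clip_snd \<sigma> (w i)", OF clip]
      by (simp only: Z_upd Z_def[of w])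
  qed
  \<comment> \<open>The entropy theorem with a = \<eta> / 2, which gives the sharper denominator 1 -
    \<eta> lam / 2.\<close>
  have main: "ln (\<integral>w. exp (lam * (Z w - (\<integral>w. Z w \<partial>Q))) \<partial>Q)
      \<le> \<eta> / 2 * lam\<^sup>2 * (\<integral>w. Z w \<partial>Q) / (1 - \<eta> / 2 * lam)"
    unfolding Q_def
  proof (rule ln_integral_exp_PiM_le)
    show "prob_space P" by (rule P)
    show "Z \<in> borel_measurable (PiM {..<n} (\<lambda>_. P))" using Z_meas by (simp add: Q_def)
    show "\<bar>Z w\<bar> \<le> real n * (\<sigma>\<^sup>2 / (4 * \<gamma>) + \<sigma> * \<kappa>)" for w using Z_bounds[of w] by simp
    show "\<eta> / 2 * lam < 1" using lam0 eta0 mult_pos_pos[of \<eta> lam] by simp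
  qed (use V lam0 in auto)
  \<comment> \<open>The case n = 0 is treated apart: the product is then a single point and both
    laws give it mass 1. For n > 0 independence identifies the joint law with the product.\<close>
  have distr_T: "distr M (PiM {..<n} (\<lambda>_. S)) T = Q"
  proof (cases "n = 0")
    case True
    interpret D: prob_space "distr M (PiM {..<n} (\<lambda>_. S)) T" by (rule M.prob_space_distr[OF T_meas])
    show ?thesis
    proof (rule measure_eqI)
      fix A assume "A \<in> sets (distr M (PiM {..<n} (\<lambda>_. S)) T)"
      then have "A \<in> sets (PiM {} (\<lambda>_. S))" using True by simp
      then have "A = {} \<or> A = {\<lambda>_. undefined}" by (auto simp: PiM_empty)
      then show "emeasure (distr M (PiM {..<n} (\<lambda>_. S)) T) A = emeasure Q A"
        using D.emeasure_space_1 True by (auto simp: Q_def PiM_empty space_PiM)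
    qed (simp add: sets_Q)
  next
    case False
    then have "distr M (PiM {..<n} (\<lambda>_. S)) T = PiM {..<n} (\<lambda>i. distr M S (Y i))"
      using indep M.indep_vars_iff_distr_eq_PiM'[where I = "{..<n}" and M' = "\<lambda>_. S" and X = Y] Y
      by (auto simp: T_def[abs_def] S_def Y_def[abs_def] lessThan_empty_iff)
    also have "\<dots> = Q"
      unfolding Q_def using ident by (intro PiM_cong) (auto simp: S_def Y_def[abs_def])
    finally show ?thesis .
  qed
  have int_T: "(\<integral>\<omega>. f (T \<omega>) \<partial>M) = (\<integral>w. f w \<partial>Q)" if "f \<in> borel_measurable Q" for f :: "_ \<Rightarrow> real"
    using integral_distr[OF T_meas, of f] that
    unfolding distr_T measurable_cong_sets[OF sets_Q refl] by simp
  have U_T: "U \<omega> = U_stat N P H \<gamma> n (T \<omega>)" for \<omega>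
    unfolding U_eq by (intro U_stat_cong) (simp add: T_def Y_def)
  have U_meas: "U \<in> borel_measurable M"
    using measurable_compose[OF T_meas U_measurable[folded S_def]] by (simp add: U_T[abs_def])
  have ZT_meas: "(\<lambda>\<omega>. Z (T \<omega>)) \<in> borel_measurable M"
    by (rule measurable_compose[OF T_meas Z_meas_S])
  have "AE \<omega> in M. \<forall>i\<in>{..<n}. \<bar>snd (Y i \<omega>)\<bar> \<le> \<sigma>"
  proof (rule AE_finite_allI)
    fix i assume "i \<in> {..<n}"
    then have "distr M S (Y i) = P" using ident[of i] by (simp add: S_def Y_def[abs_def])
    then have "AE p in distr M S (Y i). \<bar>snd p\<bar> \<le> \<sigma>" using AE_snd_le by (simp only:)
    with Y[of i] \<open>i \<in> {..<n}\<close> show "AE \<omega> in M. \<bar>snd (Y i \<omega>)\<bar> \<le> \<sigma>"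
      by (intro AE_distrD[of "Y i" M S]) auto
  qed simp
  then have AE_U: "AE \<omega> in M. U \<omega> = Z (T \<omega>)"
  proof eventually_elim
    case (elim \<omega>)
    then show ?case unfolding U_T Z_def by (intro U_stat_cong) (simp add: T_def clip_snd_eq)
  qed
  have EU: "(\<integral>\<omega>. U \<omega> \<partial>M) = (\<integral>w. Z w \<partial>Q)"
    using integral_cong_AE[OF U_meas ZT_meas AE_U] int_T[OF Z_meas] by simp
  define E where "E = (\<integral>w. Z w \<partial>Q)"
  have E0: "0 \<le> E" unfolding E_def using Z_bounds by (intro Bochner_Integration.integral_nonneg)
  have "(\<integral>\<omega>. exp (lam * (U \<omega> - E)) \<partial>M) = (\<integral>\<omega>. exp (lam * (Z (T \<omega>) - E)) \<partial>M)"
    using U_meas ZT_meas AE_U by (intro integral_cong_AE) (auto elim: eventually_mono)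
  also have "\<dots> = (\<integral>w. exp (lam * (Z w - E)) \<partial>Q)"
    using Z_meas by (intro int_T) simp
  finally have "ln (\<integral>\<omega>. exp (lam * (U \<omega> - E)) \<partial>M) \<le> \<eta> / 2 * lam\<^sup>2 * E / (1 - \<eta> / 2 * lam)"
    using main by (simp add: E_def)
  \<comment> \<open>Shrinking the denominator to 1 - \<eta> lam increases the quotient because the
    mean E is nonnegative.\<close>
  also have "\<dots> \<le> \<eta> / 2 * lam\<^sup>2 * E / (1 - \<eta> * lam)"
    using eta0 lam0 E0 by (intro divide_left_mono mult_nonneg_nonneg mult_pos_pos) auto
  also have "\<dots> = lam\<^sup>2 * \<eta> * E / (2 * (1 - \<eta> * lam))"
    by (simp add: mult_ac)
  finally show ?thesis by (simp add: EU E_def)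
qed

end
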